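(* Let Assumption 1 (stated in the context) hold, let $F$ be differentiable, and let $\mathcal X=\mathbb R^n$. Let $\{(x_k,y_k)\}$ be generated by the basic SCGD algorithm (defined in the context) with stepsizes $$\alpha_k=k^{-a},\qquad\beta_k=k^{-b},$$ where $a,b$ are scalars in $(0,1)$. Let $$T_\epsilon=\min\Big\{k:\ \inf_{0\le t\le k}\mathbf E[\|\nabla F(x_t)\|^2]\le\epsilon\Big\}.$$ Then $$T_\epsilon\le\mathcal O(\epsilon^{-1/p}),\qquad\text{where } p=\min\{1-a,\ a-b,\ 2b-a,\ a\}.$$ By minimizing this complexity bound over $a,b$, one obtains $T_\epsilon\le\mathcal O(\epsilon^{-4})$ with $a=3/4$, $b=1/2$.
   Context: Problem. Minimize $F(x)=f(g(x))$ over $x\in\mathcal X\subset\mathbb R^n$, where $f:\mathbb R^m\to\mathbb R$, $g:\mathbb R^n\to\mathbb R^m$ are continuous, $f(y)=\mathbf E[f_v(y)]$, $g(x)=\mathbf E[g_w(x)]$, and $(w,v)$ is a pair of (possibly dependent) random variables. Standing assumption: the problem has at least one optimal solution $x^*\in\mathcal X$. $\|\cdot\|$ is the Euclidean norm (operator norm for matrices) and $\Pi_{\mathcal X}$ is Euclidean projection onto $\mathcal X$ (the identity when $\mathcal X=\mathbb R^n$). $\partial F(x)$ is the subdifferential of $F$ at $x$, read as $\{\nabla F(x)\}$ when $F$ is differentiable. For each realization $w$ and each $x\in\mathcal X$, $\widetilde\nabla g_w(x)\in\mathbb R^{n\times m}$ is a given matrix whose columns are noisy gradients/subgradients of the components of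 $g$. The constant hidden in $\mathcal O(\cdot)$ does not depend on $\epsilon$. Assumption 1. There are positive scalars $C_g,C_f,V_g,L_f$ such that: (i) $f$ is continuously differentiable, $g$ is continuous, and $\mathcal X$ is closed and convex. (ii) $(w_0,v_0),(w_1,v_1),\dots$ are i.i.d. (copies of $(w,v)$), and with probability 1, for all $x\in\mathcal X$, $\mathbf E[g_{w_0}(x)\mid v_0]=g(x)$ and $\mathbf E[\widetilde\nabla g_{w_0}(x)\nabla f_{v_0}(g(x))\mid v_0]\in\partial F(x)$. (iii) $g$ is Lipschitz continuous with parameter $C_g$, and with probability 1, for all $x\in\mathcal X$, $\mathbf E[\|\widetilde\nabla g_{w_0}(x)\|^2\mid v_0]\le C_g$ and $\mathbf E[\|g_{w_0}(x)-g(x)\|^2\mid v_0]\le V_g$. (iv) $f$ and $f_v$ have Lipschitz continuous gradients, such that with probability 1, for all $y,\bar y\in\mathbb R^m$, $\mathbf E[\|\nabla f_{v_0}(y)\|^2\mid w_0]\le C_f$ and $\|\nabla f_{v_0}(y)-\nabla f_{v_0}(\bar y)\|\le L_f\|y-\bar y\|$. Basic SCGD algorithm. Given $x_0\in\mathbb R^n$, $y_0\in\mathbb R^m$ and stepsizes $\alpha_k,\beta_k\in(0,1]$, for $k=0,1,2,\dots$: $$y_{k+1}=(1-\beta_k)y_k+\beta_k g_{w_k}(x_k),\qquad x_{k+1}=\Pi_{\mathcal X}\big\{x_k-\alpha_k\widetilde\nabla g_{w_k}(x_k)\nabla f_{v_k}(y_{k+1})\big\}.$$ The stepsize formulas above are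 for $k\ge1$; $\alpha_0,\beta_0$ are any numbers in $(0,1]$.
   Formalization: The gradient of F is assumed Lipschitz continuous, not merely F differentiable (otherwise the rate fails, e.g. for F behaving like |x|^{1+d} near 0 with small d), and p>0 is required, since the bound is undefined for p=0 and false for p<0. *)

theory Defs
  imports "HOL-Probability.Probability" "HOL-Library.Landau_Symbols"
begin

definition grad :: "('b::real_inner \<Rightarrow> real) \<Rightarrow> 'b \<Rightarrow> 'b" where
  "grad h z = (THE d. GDERIV h z :> d)"

text \<open>The subdifferential of convex analysis, read as the singleton of the gradient wherever
  the function is differentiable (whether or not it is convex).\<close>

definition subdiff :: "('b::real_inner \<Rightarrow> real) \<Rightarrow> 'b \<Rightarrow> 'b set" where
  "subdiff h z =
     (if h differentiable (at z) then {grad h z}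
      else {d. \<forall>z'. h z' \<ge> h z + d \<bullet> (z' - z)})"

text \<open>Componentwise conditional expectation of a random vector. As for \<^const>\<open>real_cond_exp\<close>,
  this is meaningful only for integrable vectors. In the locale below integrability is either
  assumed or a consequence of the second moment bounds.\<close>

definition vec_cond_exp :: "'a measure \<Rightarrow> 'a measure \<Rightarrow> ('a \<Rightarrow> real ^ 'k) \<Rightarrow> 'a \<Rightarrow> real ^ 'k" where
  "vec_cond_exp M N Z \<omega> = (\<chi> i. real_cond_exp M N (\<lambda>\<omega>'. Z \<omega>' $ i) \<omega>)"

text \<open>The problem of minimizing \<open>f \<circ> g\<close> over \<open>X\<close>, with sampling oracles \<open>gw\<close> (values of \<open>g\<close>),
  \<open>G\<close> (the \<open>n \<times> m\<close> matrix of noisy gradients of \<open>g\<close>) and \<open>fv\<close>. Joint measurability of the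
  oracles is what makes the iterates of the algorithm random variables.

  A conditional expectation is determined only up to a null set. Hence conditions holding
  ``with probability 1, for all \<open>x\<close>'' that involve one are stated for each \<open>x\<close>, almost surely;
  this asks for less than a common null set for all \<open>x\<close>. The second moment bounds use
  \<^const>\<open>nn_cond_exp\<close>, so that an infinite moment is not mistaken for \<open>0\<close>.\<close>

locale scgd_problem = prob_space M
  for M :: "'a measure" +
  fixes W :: "'w measure" and V :: "'v measure"
    and w :: "nat \<Rightarrow> 'a \<Rightarrow> 'w" and v :: "nat \<Rightarrow> 'a \<Rightarrow> 'v"
    and f :: "real ^ 'm \<Rightarrow> real" and fv :: "'v \<Rightarrow> real ^ 'm \<Rightarrow> real"
    and g :: "real ^ 'n \<Rightarrow> real ^ 'm" and gw :: "'w \<Rightarrow> real ^ 'n \<Rightarrow> real ^ 'm"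
    and G :: "'w \<Rightarrow> real ^ 'n \<Rightarrow> real ^ 'm ^ 'n"
    and X :: "(real ^ 'n) set"
  assumes measurable_fv: "(\<lambda>(u, z). fv u z) \<in> borel_measurable (V \<Otimes>\<^sub>M borel)"
    and measurable_gw: "(\<lambda>(u, z). gw u z) \<in> borel_measurable (W \<Otimes>\<^sub>M borel)"
    and measurable_G: "(\<lambda>(u, z). G u z) \<in> borel_measurable (W \<Otimes>\<^sub>M borel)"
    and indep: "indep_vars (\<lambda>_. W \<Otimes>\<^sub>M V) (\<lambda>k \<omega>. (w k \<omega>, v k \<omega>)) UNIV"
    and identically_distributed:
      "\<And>k. distr M (W \<Otimes>\<^sub>M V) (\<lambda>\<omega>. (w k \<omega>, v k \<omega>)) =
            distr M (W \<Otimes>\<^sub>M V) (\<lambda>\<omega>. (w 0 \<omega>, v 0 \<omega>))"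
    and integrable_fv: "\<And>z. integrable M (\<lambda>\<omega>. fv (v 0 \<omega>) z)"
    and f_eq: "\<And>z. f z = expectation (\<lambda>\<omega>. fv (v 0 \<omega>) z)"
    and integrable_gw: "\<And>z. integrable M (\<lambda>\<omega>. gw (w 0 \<omega>) z)"
    and g_eq: "\<And>z. g z = expectation (\<lambda>\<omega>. gw (w 0 \<omega>) z)"
    and continuous_f: "continuous_on UNIV f"
    and continuous_g: "continuous_on UNIV g"
    and optimal_solution: "\<exists>xs\<in>X. \<forall>z\<in>X. (f \<circ> g) xs \<le> (f \<circ> g) z"

locale scgd_assumption = scgd_problem M W V w v f fv g gw G X
  for M :: "'a measure" and W :: "'w measure" and V :: "'v measure"
    and w :: "nat \<Rightarrow> 'a \<Rightarrow> 'w" and v :: "nat \<Rightarrow> 'a \<Rightarrow> 'v"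
    and f :: "real ^ 'm \<Rightarrow> real" and fv :: "'v \<Rightarrow> real ^ 'm \<Rightarrow> real"
    and g :: "real ^ 'n \<Rightarrow> real ^ 'm" and gw :: "'w \<Rightarrow> real ^ 'n \<Rightarrow> real ^ 'm"
    and G :: "'w \<Rightarrow> real ^ 'n \<Rightarrow> real ^ 'm ^ 'n"
    and X :: "(real ^ 'n) set" +
  fixes C\<^sub>g C\<^sub>f V\<^sub>g L\<^sub>f :: real
  assumes positive: "C\<^sub>g > 0" "C\<^sub>f > 0" "V\<^sub>g > 0" "L\<^sub>f > 0"
    and f_differentiable: "\<And>z. f differentiable (at z)"
    and f_continuous_grad: "continuous_on UNIV (grad f)"
    and closed_X: "closed X" and convex_X: "convex X"
    and gw_unbiased: "\<And>x. x \<in> X \<Longrightarrow>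
      AE \<omega> in M. vec_cond_exp M (vimage_algebra (space M) (v 0) V)
        (\<lambda>\<omega>. gw (w 0 \<omega>) x) \<omega> = g x"
    and gradient_unbiased: "\<And>x. x \<in> X \<Longrightarrow>
      AE \<omega> in M. vec_cond_exp M (vimage_algebra (space M) (v 0) V)
        (\<lambda>\<omega>. G (w 0 \<omega>) x *v grad (fv (v 0 \<omega>)) (g x)) \<omega> \<in> subdiff (f \<circ> g) x"
    and g_lipschitz: "C\<^sub>g-lipschitz_on UNIV g"
    and G_second_moment: "\<And>x. x \<in> X \<Longrightarrow>
      AE \<omega> in M. nn_cond_exp M (vimage_algebra (space M) (v 0) V)
        (\<lambda>\<omega>. ennreal ((onorm ((*v) (G (w 0 \<omega>) x)))\<^sup>2)) \<omega> \<le> ennreal C\<^sub>g"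
    and gw_variance: "\<And>x. x \<in> X \<Longrightarrow>
      AE \<omega> in M. nn_cond_exp M (vimage_algebra (space M) (v 0) V)
        (\<lambda>\<omega>. ennreal ((norm (gw (w 0 \<omega>) x - g x))\<^sup>2)) \<omega> \<le> ennreal V\<^sub>g"
    and f_lipschitz_grad: "\<exists>L. L-lipschitz_on UNIV (grad f)"
    and fv_differentiable: "\<And>u z. u \<in> space V \<Longrightarrow> fv u differentiable (at z)"
    and fv_second_moment: "\<And>z.
      AE \<omega> in M. nn_cond_exp M (vimage_algebra (space M) (w 0) W)
        (\<lambda>\<omega>. ennreal ((norm (grad (fv (v 0 \<omega>)) z))\<^sup>2)) \<omega> \<le> ennreal C\<^sub>f"
    and fv_lipschitz_grad: "AE \<omega> in M. \<forall>z z'.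
      norm (grad (fv (v 0 \<omega>)) z - grad (fv (v 0 \<omega>)) z') \<le> L\<^sub>f * norm (z - z')"

definition scgd_iterates ::
  "'a measure \<Rightarrow> (nat \<Rightarrow> 'a \<Rightarrow> 'w) \<Rightarrow> (nat \<Rightarrow> 'a \<Rightarrow> 'v) \<Rightarrow> ('v \<Rightarrow> real ^ 'm \<Rightarrow> real) \<Rightarrow>
   ('w \<Rightarrow> real ^ 'n \<Rightarrow> real ^ 'm) \<Rightarrow> ('w \<Rightarrow> real ^ 'n \<Rightarrow> real ^ 'm ^ 'n) \<Rightarrow> (real ^ 'n) set \<Rightarrow>
   (nat \<Rightarrow> real) \<Rightarrow> (nat \<Rightarrow> real) \<Rightarrow> real ^ 'n \<Rightarrow> real ^ 'm \<Rightarrow>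
   (nat \<Rightarrow> 'a \<Rightarrow> real ^ 'n) \<Rightarrow> (nat \<Rightarrow> 'a \<Rightarrow> real ^ 'm) \<Rightarrow> bool" where
  "scgd_iterates M w v fv gw G X \<alpha> \<beta> x0 y0 x y \<longleftrightarrow>
     (\<forall>\<omega>\<in>space M. x 0 \<omega> = x0 \<and> y 0 \<omega> = y0 \<and>
       (\<forall>k. y (Suc k) \<omega> = (1 - \<beta> k) *\<^sub>R y k \<omega> + \<beta> k *\<^sub>R gw (w k \<omega>) (x k \<omega>) \<and>
            x (Suc k) \<omega> = closest_point X
              (x k \<omega> - \<alpha> k *\<^sub>R (G (w k \<omega>) (x k \<omega>) *v grad (fv (v k \<omega>)) (y (Suc k) \<omega>)))))"

definition power_stepsizes :: "real \<Rightarrow> real \<Rightarrow> (nat \<Rightarrow> real) \<Rightarrow> (nat \<Rightarrow> real) \<Rightarrow> bool" where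
  "power_stepsizes a b \<alpha> \<beta> \<longleftrightarrow>
     \<alpha> 0 \<in> {0<..1} \<and> \<beta> 0 \<in> {0<..1} \<and>
     (\<forall>k\<ge>1. \<alpha> k = real k powr (-a) \<and> \<beta> k = real k powr (-b))"

definition small_gradient ::
  "'a measure \<Rightarrow> ('b::euclidean_space \<Rightarrow> real) \<Rightarrow> (nat \<Rightarrow> 'a \<Rightarrow> 'b) \<Rightarrow> real \<Rightarrow> nat \<Rightarrow> bool" where
  "small_gradient M F x \<epsilon> k \<longleftrightarrow>
     (INF t\<in>{0..k}. \<integral>\<^sup>+ \<omega>. ennreal ((norm (grad F (x t \<omega>)))\<^sup>2) \<partial>M) \<le> ennreal \<epsilon>"

definition iteration_complexity ::
  "'a measure \<Rightarrow> ('b::euclidean_space \<Rightarrow> real) \<Rightarrow> (nat \<Rightarrow> 'a \<Rightarrow> 'b) \<Rightarrow> real \<Rightarrow> nat" where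
  "iteration_complexity M F x \<epsilon> = (LEAST k. small_gradient M F x \<epsilon> k)"

definition rate_exponent :: "real \<Rightarrow> real \<Rightarrow> real" where
  "rate_exponent a b = Min {1 - a, a - b, 2 * b - a, a}"

end

(*
  Write d_k = E |y_k - g(x_k)|^2. Given the past, the noise in y_{k+1} enters the bias of the search
  direction only through beta_k times a product of second moments, while y_k - g(x_k) is
  independent of the k-th sample. Hence, up to constants,

    E F(x_{k+1}) + alpha_k / 2 E |grad F(x_k)|^2 <= E F(x_k) + alpha_k d_k + alpha_k beta_k^2 + alpha_k^2,
    d_{k+1} <= (1 - beta_k) d_k + beta_k^2 + alpha_k^2 / beta_k.

  Adding alpha_k / beta_k times the second line to the first cancels alpha_k d_k and leaves errors of
  order k^(-s) with s in {2a, a + 2b, a + b, 3a - 2b}. All of these exceed a + p, so the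
  errors sum to O(K^(1 - a - p)); as the stepsizes sum to at least K^(1 - a), the smallest
  gradient among the first K is O(K^(-p)). Absorbing the tracking error d_{k+1} with weight beta_k
  instead would give errors of order 1 / k, hence an extra logarithm, at a = 3/4, b = 1/2.
*)
theory Submission
  imports Defs
begin

text \<open>Two obstacles shape the argument. The samples \<open>w k\<close> and \<open>v k\<close>
  may be dependent, and \<open>y (Suc k)\<close> already contains a value of
  \<open>gw (w k)\<close>; so the moment bound on the gradient of \<open>fv\<close>, assumed at
  fixed points given \<open>w 0\<close>, has to be extended to points that depend on
  \<open>w 0\<close>. Moreover, nothing guarantees beforehand that \<open>F (x k)\<close> or the
  squared tracking error has a finite expectation. Therefore the recursions are first proved between
  nonnegative integrals, with F replaced by its excess over a lower bound, and finiteness comes out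
  of the recursions themselves.

  The estimates are confined to one fixed pair of points and the sample with index 0. Independence
  and equality of laws carry them to every k through a single integral identity, and what remains
  concerns deterministic sequences.\<close>

section \<open>Gradients and the descent inequality\<close>

lemma GDERIV_grad:
  fixes h :: "'b::euclidean_space \<Rightarrow> real"
  assumes "h differentiable (at z)"
  shows "GDERIV h z :> grad h z"
proof -
  from assms obtain D where D: "(h has_derivative D) (at z)"
    unfolding differentiable_def by blast
  then have lin: "linear D"
    using has_derivative_bounded_linear bounded_linear.linear by blast
  \<comment> \<open>The Riesz representative of the functional \<open>D\<close> is the image of 1
    under its adjoint.\<close>
  have "D = (\<lambda>u. u \<bullet> adjoint D 1)"
    using adjoint_works[OF lin, of _ 1] by (simp add: fun_eq_iff)
  with D have ex: "GDERIV h z :> adjoint D 1"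
    unfolding gderiv_def by simp
  have unique: "d = adjoint D 1" if "GDERIV h z :> d" for d
  proof -
    have "(\<lambda>u. u \<bullet> d) = (\<lambda>u. u \<bullet> adjoint D 1)"
      using that ex unfolding gderiv_def by (rule has_derivative_unique)
    then have "(d - adjoint D 1) \<bullet> d = (d - adjoint D 1) \<bullet> adjoint D 1"
      by (rule fun_cong)
    then have "(d - adjoint D 1) \<bullet> (d - adjoint D 1) = 0"
      by (simp add: inner_diff_right)
    then show ?thesis by simp
  qed
  show ?thesis
    unfolding grad_def using ex unique by (rule theI)
qed

text \<open>The mean value theorem on the segment takes the place of integrating the gradient. It
  evaluates the gradient at one unknown point of the segment, which loses the usual factor 1/2 in
  front of L; only constants are affected.\<close>

lemma descent_lemma:
  fixes h :: "'b::euclidean_space \<Rightarrow> real"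
  assumes diff: "\<And>z. h differentiable (at z)"
    and lip: "L-lipschitz_on UNIV (grad h)"
  shows "h z' \<le> h z + grad h z \<bullet> (z' - z) + L * (norm (z' - z))\<^sup>2"
proof -
  define p where "p t = z + t *\<^sub>R (z' - z)" for t :: real
  have der: "((\<lambda>t. h (p t)) has_derivative (\<lambda>s. (s *\<^sub>R (z' - z)) \<bullet> grad h (p t))) (at t within {0..1})" for t
  proof -
    have "(p has_derivative (\<lambda>s. s *\<^sub>R (z' - z))) (at t within {0..1})"
      unfolding p_def by (auto intro!: derivative_eq_intros)
    moreover have "(h has_derivative (\<lambda>u. u \<bullet> grad h (p t))) (at (p t) within p ` {0..1})"
      using GDERIV_grad[OF diff] unfolding gderiv_def by (blast intro: has_derivative_at_withinI)
    ultimately show ?thesis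
      using has_derivative_in_compose by fastforce
  qed
  have "\<exists>t\<in>{0..1::real}. h (p 1) - h (p 0) = ((1 - 0) *\<^sub>R (z' - z)) \<bullet> grad h (p t)"
    by (rule mvt_very_simple[OF _ der]) simp_all
  then obtain t :: real where t: "t \<in> {0..1}"
    and eq: "h z' - h z = (z' - z) \<bullet> grad h (p t)"
    by (auto simp: p_def)
  have L: "0 \<le> L" using lip by (rule lipschitz_on_nonneg)
  have "norm (grad h (p t) - grad h z) \<le> L * norm (p t - z)"
    using lipschitz_onD[OF lip, of "p t" z] by (simp add: dist_norm)
  also have "\<dots> \<le> L * norm (z' - z)"
    using t L by (intro mult_left_mono) (auto simp: p_def intro: mult_left_le_one_le)
  finally have gb: "norm (grad h (p t) - grad h z) \<le> L * norm (z' - z)" .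
  have "h z' - h z - grad h z \<bullet> (z' - z) = (z' - z) \<bullet> (grad h (p t) - grad h z)"
    unfolding eq by (simp add: inner_diff_right inner_commute)
  also have "\<dots> \<le> norm (z' - z) * norm (grad h (p t) - grad h z)"
    by (rule norm_cauchy_schwarz)
  also have "\<dots> \<le> norm (z' - z) * (L * norm (z' - z))"
    using gb by (intro mult_left_mono) auto
  finally show ?thesis by (simp add: power2_eq_square algebra_simps)
qed

section \<open>Operator norms and measurability\<close>

lemma norm_matrix_mult_le:
  fixes A :: "real ^ 'p ^ 'q"
  shows "norm (A *v z) \<le> onorm ((*v) A) * norm z"
  by (rule onorm) (simp add: matrix_vector_mul_bounded_linear)

text \<open>By the triangle inequality and the entrywise bound, the operator norm is Lipschitz for
  the Euclidean norm, with the number of entries as a crude constant. Continuity is what yields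
  measurability of the random operator norm.\<close>

lemma continuous_on_onorm_matrix:
  "continuous_on UNIV (\<lambda>A :: real ^ 'm ^ 'n. onorm ((*v) A))"
proof -
  let ?c = "real CARD('n) * real CARD('m)"
  have bl: "bounded_linear ((*v) A)" for A :: "real ^ 'm ^ 'n"
    by (simp add: matrix_vector_mul_bounded_linear)
  have *: "onorm ((*v) A) - onorm ((*v) B) \<le> ?c * norm (A - B)" for A B :: "real ^ 'm ^ 'n"
  proof -
    have "onorm (\<lambda>x. B *v x + (A - B) *v x) \<le> onorm ((*v) B) + onorm ((*v) (A - B))"
      using bl by (rule onorm_triangle) (rule bl)
    moreover have "(\<lambda>x. B *v x + (A - B) *v x) = (*v) A"
      by (simp add: fun_eq_iff matrix_vector_mult_diff_rdistrib)
    moreover have "\<bar>(A - B) $ i $ j\<bar> \<le> norm (A - B)" for i j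
      by (rule order_trans[OF component_le_norm_cart Finite_Cartesian_Product.norm_nth_le])
    then have "onorm ((*v) (A - B)) \<le> ?c * norm (A - B)"
      by (rule onorm_le_matrix_component)
    ultimately show ?thesis by simp
  qed
  have "?c-lipschitz_on UNIV (\<lambda>A :: real ^ 'm ^ 'n. onorm ((*v) A))"
  proof (rule lipschitz_onI)
    fix A B :: "real ^ 'm ^ 'n"
    show "dist (onorm ((*v) A)) (onorm ((*v) B)) \<le> ?c * dist A B"
      using *[of A B] *[of B A] by (auto simp: dist_norm norm_minus_commute abs_le_iff)
  qed simp
  then show ?thesis by (rule lipschitz_on_continuous_on)
qed

lemma borel_measurable_onorm_matrix [measurable (raw)]:
  fixes A :: "'a \<Rightarrow> real ^ 'm ^ 'n"
  assumes "A \<in> borel_measurable M"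
  shows "(\<lambda>x. onorm ((*v) (A x))) \<in> borel_measurable M"
  using continuous_on_onorm_matrix assms by (rule borel_measurable_continuous_on)

lemma borel_measurable_matrix_vector_mult [measurable (raw)]:
  fixes A :: "'a \<Rightarrow> real ^ 'm ^ 'n"
  assumes [measurable]: "A \<in> borel_measurable M" "b \<in> borel_measurable M"
  shows "(\<lambda>x. A x *v b x) \<in> borel_measurable M"
proof -
  have "continuous_on UNIV (\<lambda>p :: (real ^ 'm ^ 'n) \<times> (real ^ 'm). fst p *v snd p)"
    unfolding matrix_vector_mult_def by (intro continuous_intros)
  then have "(\<lambda>x. fst (A x, b x) *v snd (A x, b x)) \<in> borel_measurable M"
    by (rule borel_measurable_continuous_on) measurable
  then show ?thesis by simp
qed

text \<open>Each coordinate of the gradient is a pointwise limit of difference quotients with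
  increments 1 / (n + 1), and these are jointly measurable because \<open>h\<close> is.\<close>

lemma borel_measurable_grad:
  fixes h :: "'v \<Rightarrow> real ^ 'k \<Rightarrow> real"
  assumes [measurable]: "(\<lambda>(u, z). h u z) \<in> borel_measurable (V \<Otimes>\<^sub>M borel)"
    and diff: "\<And>u z. u \<in> space V \<Longrightarrow> h u differentiable (at z)"
  shows "(\<lambda>(u, z). grad (h u) z) \<in> borel_measurable (V \<Otimes>\<^sub>M borel)"
proof (subst borel_measurable_euclidean_space, intro ballI)
  fix b :: "real ^ 'k" assume b: "b \<in> Basis"
  define q where "q n p = (h (fst p) (snd p + (1 / real (Suc n)) *\<^sub>R b) - h (fst p) (snd p)) / (1 / real (Suc n))"
    for n and p :: "'v \<times> (real ^ 'k)"
  show "(\<lambda>p. (case p of (u, z) \<Rightarrow> grad (h u) z) \<bullet> b) \<in> borel_measurable (V \<Otimes>\<^sub>M borel)"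
  proof (rule borel_measurable_LIMSEQ_real)
    show "q n \<in> borel_measurable (V \<Otimes>\<^sub>M borel)" for n
      unfolding q_def by measurable
    fix p assume p: "p \<in> space (V \<Otimes>\<^sub>M (borel :: (real ^ 'k) measure))"
    obtain u z where [simp]: "p = (u, z)" by fastforce
    have u: "u \<in> space V" using p by (simp add: space_pair_measure)
    have "(h u has_derivative (\<lambda>d. d \<bullet> grad (h u) z)) (at z)"
      using GDERIV_grad[OF diff[OF u]] unfolding gderiv_def .
    then have der: "((\<lambda>t. h u (z + t *\<^sub>R b)) has_derivative (\<lambda>t. (t *\<^sub>R b) \<bullet> grad (h u) z)) (at 0)"
      by (intro has_derivative_compose[where g = "h u" and f = "\<lambda>t. z + t *\<^sub>R b", simplified])
        (auto intro!: derivative_eq_intros)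
    have "((\<lambda>t. h u (z + t *\<^sub>R b)) has_real_derivative (b \<bullet> grad (h u) z)) (at 0)"
      unfolding has_field_derivative_def
      by (rule has_derivative_eq_rhs[OF der]) (simp add: fun_eq_iff mult.commute)
    then have "((\<lambda>t. (h u (z + t *\<^sub>R b) - h u z) / t) \<longlongrightarrow> b \<bullet> grad (h u) z) (at 0)"
      by (simp add: has_field_derivative_iff)
    moreover have "filterlim (\<lambda>n. 1 / real (Suc n)) (at 0) sequentially"
      using LIMSEQ_Suc[OF lim_1_over_n] by (auto simp: filterlim_at)
    ultimately have "((\<lambda>n. (h u (z + (1 / real (Suc n)) *\<^sub>R b) - h u z) / (1 / real (Suc n)))
        \<longlongrightarrow> b \<bullet> grad (h u) z) sequentially"
      by (rule filterlim_compose)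
    then show "(\<lambda>n. q n p) \<longlonglongrightarrow> (case p of (u, z) \<Rightarrow> grad (h u) z) \<bullet> b"
      by (simp add: q_def inner_commute)
  qed
qed

section \<open>Rates from the coupled scalar recursions\<close>

lemma rate_exponent_le:
  "rate_exponent a b \<le> 1 - a" "rate_exponent a b \<le> a - b" "rate_exponent a b \<le> 2 * b - a"
  unfolding rate_exponent_def by simp_all

text \<open>The factor k^(1 - q) of k^(-r) is at most K^(1 - q), and the remaining series converges
  because r > q. The case q = 1, where the sum stays bounded, is covered together with q <
  1.\<close>

lemma sum_powr_le:
  fixes q r :: real
  assumes q: "q \<le> 1" "q < r" and K: "1 \<le> K"
  shows "(\<Sum>k=1..K. real k powr (- r)) \<le> real K powr (1 - q) * (\<Sum>k. real k powr (- (1 + r - q)))"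
proof -
  have "(\<Sum>k=1..K. real k powr (- r)) \<le> (\<Sum>k=1..K. real K powr (1 - q) * real k powr (- (1 + r - q)))"
  proof (rule sum_mono)
    fix k assume k: "k \<in> {1..K}"
    have "real k powr (- r) = real k powr (1 - q) * real k powr (- (1 + r - q))"
      by (simp flip: powr_add)
    also have "\<dots> \<le> real K powr (1 - q) * real k powr (- (1 + r - q))"
      using q k by (intro mult_right_mono powr_mono2) auto
    finally show "real k powr (- r) \<le> real K powr (1 - q) * real k powr (- (1 + r - q))" .
  qed
  also have "\<dots> = real K powr (1 - q) * (\<Sum>k=1..K. real k powr (- (1 + r - q)))"
    by (rule sum_distrib_left[symmetric])
  also have "(\<Sum>k=1..K. real k powr (- (1 + r - q))) \<le> (\<Sum>k. real k powr (- (1 + r - q)))"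
    using q by (intro sum_le_suminf) (auto simp: summable_real_powr_iff)
  finally show ?thesis by (simp add: mult_left_mono)
qed

text \<open>\<open>A\<close>, \<open>D\<close> and \<open>N\<close> stand for the expected excess of
  the objective, the tracking error and the squared gradient. The summation starts at index 1
  because the step sizes at index 0 are arbitrary; their effect is hidden in the potential at index
  1.\<close>

lemma two_timescale_rate:
  fixes A D N \<alpha> \<beta> :: "nat \<Rightarrow> real"
  assumes ab: "0 < a" "0 < b" and pos: "0 < rate_exponent a b"
    and \<alpha>: "\<And>k. 1 \<le> k \<Longrightarrow> \<alpha> k = real k powr (- a)"
    and \<beta>: "\<And>k. 1 \<le> k \<Longrightarrow> \<beta> k = real k powr (- b)"
    and nonneg: "\<And>k. 0 \<le> A k" "\<And>k. 0 \<le> D k"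
    and c: "0 \<le> c1" "0 \<le> c2" "0 \<le> c3" "0 \<le> c4" "0 \<le> c5"
    and A: "\<And>k. A (Suc k) + \<alpha> k / 2 * N k \<le> A k + c1 * \<alpha> k * D k + (c2 * \<alpha> k * (\<beta> k)\<^sup>2 + c3 * (\<alpha> k)\<^sup>2)"
    and D: "\<And>k. D (Suc k) \<le> (1 - \<beta> k) * D k + (c4 * (\<beta> k)\<^sup>2 + c5 * ((\<alpha> k)\<^sup>2 / \<beta> k))"
  shows "\<exists>C>0. \<forall>K\<ge>1. \<exists>t\<in>{1..K}. N t \<le> C * real K powr (- rate_exponent a b)"
proof -
  define p where "p = rate_exponent a b"
  \<comment> \<open>The smallest exponent among the error terms; a + 2 * b is left out since it
    exceeds a + b.\<close>
  define r where "r = min (2 * a) (min (a + b) (3 * a - 2 * b))"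
  define q where "q = a + p"
  have p: "0 < p" "p \<le> 1 - a" "p \<le> a - b" "p \<le> 2 * b - a"
    unfolding p_def using pos rate_exponent_le by auto
  \<comment> \<open>With p > 0, the bound p <= a - b gives p < a and p < 2 * (a - b). Adding it to p
    <= 2 * b - a gives 2 * p <= b, hence p < b.\<close>
  have qr: "q \<le> 1" "q < r"
    using p ab unfolding q_def r_def by auto
  define \<gamma> where "\<gamma> k = real k powr (b - a)" for k :: nat
  define \<Phi> where "\<Phi> k = A k + c1 * \<gamma> k * D k" for k
  define E where "E = c2 + c3 + c1 * c4 + c1 * c5"
  have E: "0 \<le> E" unfolding E_def using c by simp
  have step: "\<Phi> (Suc k) + \<alpha> k / 2 * N k \<le> \<Phi> k + E * real k powr (- r)" if k: "1 \<le> k" for k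
  proof -
    \<comment> \<open>The weight is nonincreasing because b < a, so its next value may be replaced
      by the present one.\<close>
    have "\<gamma> (Suc k) \<le> \<gamma> k"
      using k p unfolding \<gamma>_def by (intro powr_mono2') auto
    then have "c1 * \<gamma> (Suc k) * D (Suc k) \<le> c1 * \<gamma> k * D (Suc k)"
      using c nonneg by (intro mult_right_mono mult_left_mono)
    also have "\<dots> \<le> c1 * \<gamma> k * ((1 - \<beta> k) * D k + (c4 * (\<beta> k)\<^sup>2 + c5 * ((\<alpha> k)\<^sup>2 / \<beta> k)))"
      using c D by (intro mult_left_mono) (auto simp: \<gamma>_def)
    also have "\<dots> = c1 * \<gamma> k * D k - c1 * (\<gamma> k * \<beta> k) * D k
        + (c1 * c4 * (\<gamma> k * (\<beta> k)\<^sup>2) + c1 * c5 * (\<gamma> k * ((\<alpha> k)\<^sup>2 / \<beta> k)))"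
      by (simp add: algebra_simps)
    also have "\<gamma> k * \<beta> k = \<alpha> k"
      using k by (simp add: \<gamma>_def \<alpha> \<beta> flip: powr_add)
    finally have "\<Phi> (Suc k) + \<alpha> k / 2 * N k \<le> \<Phi> k + (c2 * (\<alpha> k * (\<beta> k)\<^sup>2) + c3 * (\<alpha> k)\<^sup>2)
        + (c1 * c4 * (\<gamma> k * (\<beta> k)\<^sup>2) + c1 * c5 * (\<gamma> k * ((\<alpha> k)\<^sup>2 / \<beta> k)))"
      using A[of k] unfolding \<Phi>_def by simp
    also have "\<alpha> k * (\<beta> k)\<^sup>2 = real k powr (- (a + 2 * b))"
      using k by (simp add: \<alpha> \<beta> power2_eq_square flip: powr_add)
    also have "(\<alpha> k)\<^sup>2 = real k powr (- (2 * a))"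
      using k by (simp add: \<alpha> power2_eq_square flip: powr_add)
    also have "\<gamma> k * (\<beta> k)\<^sup>2 = real k powr (- (a + b))"
      using k by (simp add: \<gamma>_def \<beta> power2_eq_square flip: powr_add) (metis minus_diff_commute)
    also have "\<gamma> k * (real k powr (- (2 * a)) / \<beta> k) = real k powr (- (3 * a - 2 * b))"
      using k by (simp add: \<gamma>_def \<beta> flip: powr_add powr_diff)
    also have "\<Phi> k + (c2 * real k powr (- (a + 2 * b)) + c3 * real k powr (- (2 * a)))
        + (c1 * c4 * real k powr (- (a + b)) + c1 * c5 * real k powr (- (3 * a - 2 * b)))
      \<le> \<Phi> k + (c2 * real k powr (- r) + c3 * real k powr (- r))
        + (c1 * c4 * real k powr (- r) + c1 * c5 * real k powr (- r))"
      using k c ab unfolding r_def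
      by (intro add_mono mult_left_mono powr_mono order_refl) auto
    also have "\<dots> = \<Phi> k + E * real k powr (- r)"
      unfolding E_def by (simp add: algebra_simps)
    finally show ?thesis .
  qed
  have telescope: "\<Phi> (Suc K) + (\<Sum>k=1..K. \<alpha> k / 2 * N k) \<le> \<Phi> 1 + (\<Sum>k=1..K. E * real k powr (- r))" for K
  proof (induction K)
    case (Suc K)
    then show ?case using step[of "Suc K"] by simp
  qed simp
  have \<Phi>_nonneg: "0 \<le> \<Phi> k" for k
    unfolding \<Phi>_def \<gamma>_def using nonneg c by simp
  define Z where "Z = (\<Sum>k. real k powr (- (1 + r - q)))"
  have Z: "0 \<le> Z"
    unfolding Z_def using qr by (intro suminf_nonneg) (auto simp: summable_real_powr_iff)
  \<comment> \<open>The summand 1 makes the final contradiction strict: failure of the bound would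
    force C / 2 <= \<open>\<Phi> 1 + E * Z\<close>.\<close>
  define C where "C = 2 * (\<Phi> 1 + E * Z) + 1"
  have C: "0 < C"
    unfolding C_def using \<Phi>_nonneg[of 1] E Z by (simp add: add_nonneg_pos)
  have "\<exists>t\<in>{1..K}. N t \<le> C * real K powr (- p)" if K: "1 \<le> K" for K
  proof (rule ccontr)
    assume "\<not> ?thesis"
    then have large: "C * real K powr (- p) \<le> N t" if "t \<in> {1..K}" for t
      by (meson linear that)
    \<comment> \<open>A common lower bound for K terms: \<open>\<alpha>\<close> is smallest at K,
      and every gradient is assumed large. The choice q = a + p makes the total a multiple of K^(1 -
      q).\<close>
    have "C / 2 * real K powr (1 - q) = (\<Sum>k=1..K. real K powr (- a) / 2 * (C * real K powr (- p)))"
    proof -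
      have "real K powr (1 - q) = real K powr 1 * real K powr (- a) * real K powr (- p)"
        unfolding q_def by (simp only: powr_add[symmetric]) (simp add: algebra_simps)
      then show ?thesis by simp
    qed
    also have "\<dots> \<le> (\<Sum>k=1..K. \<alpha> k / 2 * N k)"
    proof (rule sum_mono)
      fix k assume k: "k \<in> {1..K}"
      then have "real K powr (- a) \<le> \<alpha> k"
        using ab by (simp add: \<alpha> powr_mono2')
      then show "real K powr (- a) / 2 * (C * real K powr (- p)) \<le> \<alpha> k / 2 * N k"
        using large[OF k] C k by (intro mult_mono) (auto simp: \<alpha>)
    qed
    also have "\<dots> \<le> \<Phi> 1 + E * (\<Sum>k=1..K. real k powr (- r))"
      using telescope[of K] \<Phi>_nonneg[of "Suc K"] by (simp add: sum_distrib_left)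
    also have "\<dots> \<le> \<Phi> 1 * real K powr (1 - q) + E * (real K powr (1 - q) * Z)"
    proof (rule add_mono)
      show "\<Phi> 1 \<le> \<Phi> 1 * real K powr (1 - q)"
      proof -
        have "1 \<le> real K powr (1 - q)"
          using K qr by (intro ge_one_powr_ge_zero) auto
        from mult_left_mono[OF this \<Phi>_nonneg[of 1]] show ?thesis by simp
      qed
      show "E * (\<Sum>k=1..K. real k powr (- r)) \<le> E * (real K powr (1 - q) * Z)"
        unfolding Z_def using E sum_powr_le[OF qr K] by (intro mult_left_mono)
    qed
    also have "\<dots> = (\<Phi> 1 + E * Z) * real K powr (1 - q)"
      by (simp add: algebra_simps)
    finally have "C / 2 \<le> \<Phi> 1 + E * Z"
      using K by simp
    then show False unfolding C_def by simp
  qed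
  with C show ?thesis unfolding p_def by blast
qed

text \<open>The first conclusion ensures that the \<open>LEAST\<close> in
  \<open>iteration_complexity\<close> is attained, so that the second one bounds a genuine stopping
  index.\<close>

lemma complexity_of_rate:
  fixes F :: "'b::euclidean_space \<Rightarrow> real"
  assumes C: "0 < C" and p: "0 < p"
    and rate: "\<And>K. 1 \<le> K \<Longrightarrow> \<exists>t\<in>{1..K}. (\<integral>\<^sup>+ \<omega>. ennreal ((norm (grad F (x t \<omega>)))\<^sup>2) \<partial>M) \<le> ennreal (C * real K powr (- p))"
  shows "\<forall>\<epsilon>>0. \<exists>k. small_gradient M F x \<epsilon> k"
    and "(\<lambda>\<epsilon>. real (iteration_complexity M F x \<epsilon>)) \<in> O[at_right 0](\<lambda>\<epsilon>. \<epsilon> powr (- 1 / p))"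
proof -
  \<comment> \<open>For \<epsilon> > 0 this is the least K \<ge> 1 with C * K^(- p) \<le>
    \<epsilon>.\<close>
  define K where "K \<epsilon> = nat \<lceil>(C / \<epsilon>) powr (1 / p)\<rceil>" for \<epsilon>
  have small: "small_gradient M F x \<epsilon> (K \<epsilon>)" if \<epsilon>: "0 < \<epsilon>" for \<epsilon>
  proof -
    have pos: "0 < (C / \<epsilon>) powr (1 / p)" using C \<epsilon> by simp
    then have K1: "1 \<le> K \<epsilon>" unfolding K_def by linarith
    have "(C / \<epsilon>) powr (1 / p) \<le> real (K \<epsilon>)"
      unfolding K_def by (rule real_nat_ceiling_ge)
    then have "((C / \<epsilon>) powr (1 / p)) powr p \<le> real (K \<epsilon>) powr p"
      using p by (intro powr_mono2) auto
    then have "C / \<epsilon> \<le> real (K \<epsilon>) powr p"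
      using p C \<epsilon> by (simp add: powr_powr)
    then have "C * real (K \<epsilon>) powr (- p) \<le> \<epsilon>"
      using \<epsilon> K1 by (simp add: powr_minus field_simps)
    moreover obtain t where "t \<in> {1..K \<epsilon>}"
      "(\<integral>\<^sup>+ \<omega>. ennreal ((norm (grad F (x t \<omega>)))\<^sup>2) \<partial>M) \<le> ennreal (C * real (K \<epsilon>) powr (- p))"
      using rate[OF K1] by blast
    ultimately show ?thesis
      unfolding small_gradient_def
      by (intro INF_lower2[of t]) (auto intro: order_trans ennreal_leI)
  qed
  then show "\<forall>\<epsilon>>0. \<exists>k. small_gradient M F x \<epsilon> k" by blast
  have bound: "real (iteration_complexity M F x \<epsilon>) \<le> (C powr (1 / p) + 1) * \<epsilon> powr (- 1 / p)"
    if \<epsilon>: "0 < \<epsilon>" "\<epsilon> < 1" for \<epsilon>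
  proof -
    have "iteration_complexity M F x \<epsilon> \<le> K \<epsilon>"
      unfolding iteration_complexity_def using small[OF \<epsilon>(1)] by (rule Least_le)
    then have "real (iteration_complexity M F x \<epsilon>) \<le> (C / \<epsilon>) powr (1 / p) + 1"
      unfolding K_def using powr_ge_zero[of "C / \<epsilon>" "1 / p"] by linarith
    also have "(C / \<epsilon>) powr (1 / p) = C powr (1 / p) * \<epsilon> powr (- 1 / p)"
      using C \<epsilon> by (simp add: powr_divide powr_minus_divide)
    finally have "real (iteration_complexity M F x \<epsilon>) \<le> C powr (1 / p) * \<epsilon> powr (- 1 / p) + 1" .
    \<comment> \<open>Since \<epsilon> < 1, the unit lost in rounding up is absorbed into the
      constant.\<close>
    moreover have "1 \<le> \<epsilon> powr (- 1 / p)"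
      using powr_mono'[of "- 1 / p" 0 \<epsilon>] \<epsilon> p by simp
    ultimately show ?thesis by (simp add: distrib_right)
  qed
  show "(\<lambda>\<epsilon>. real (iteration_complexity M F x \<epsilon>)) \<in> O[at_right 0](\<lambda>\<epsilon>. \<epsilon> powr (- 1 / p))"
    by (rule bigoI[where c = "C powr (1 / p) + 1"], rule eventually_at_rightI[of 0 1]) (use bound in \<open>auto simp del: minus_divide_left\<close>)
qed

section \<open>Conditional moment bounds and elementary inequalities\<close>

lemma finite_measure_subalgebra_vimage_algebra:
  assumes "finite_measure M" and u: "u \<in> measurable M N"
  shows "finite_measure_subalgebra M (vimage_algebra (space M) u N)"
proof -
  have "u \<in> space M \<rightarrow> space N"
    by (rule funcsetI) (rule measurable_space[OF u])
  then have "subalgebra M (vimage_algebra (space M) u N)"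
    using u unfolding subalgebra_def by (auto simp: sets_vimage_algebra2 measurable_sets)
  with assms(1) show ?thesis
    by (simp add: finite_measure_subalgebra_def finite_measure_subalgebra_axioms_def)
qed

text \<open>A weight that is a function of \<open>u\<close> is measurable for the sigma-algebra
  generated by \<open>u\<close>, so it passes through the conditional expectation. All conditional
  second moment bounds are used in this form: the constant weight 1 gives unconditional bounds,
  other weights handle products of dependent factors.\<close>

lemma (in prob_space) nn_integral_mult_le_of_nn_cond_exp_le:
  assumes u: "u \<in> measurable M N"
    and Z [measurable]: "Z \<in> borel_measurable M"
    and \<psi> [measurable]: "\<psi> \<in> borel_measurable N"
    and bound: "AE \<omega> in M. nn_cond_exp M (vimage_algebra (space M) u N) Z \<omega> \<le> c"
  shows "(\<integral>\<^sup>+ \<omega>. \<psi> (u \<omega>) * Z \<omega> \<partial>M) \<le> (\<integral>\<^sup>+ \<omega>. \<psi> (u \<omega>) \<partial>M) * c"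
proof -
  note u [measurable]
  interpret finite_measure_subalgebra M "vimage_algebra (space M) u N"
    using finite_measure_axioms u by (rule finite_measure_subalgebra_vimage_algebra)
  have "u \<in> measurable (vimage_algebra (space M) u N) N"
    by (rule measurable_vimage_algebra1[OF funcsetI]) (rule measurable_space[OF u])
  then have "(\<lambda>\<omega>. \<psi> (u \<omega>)) \<in> borel_measurable (vimage_algebra (space M) u N)"
    by measurable
  then have "(\<integral>\<^sup>+ \<omega>. \<psi> (u \<omega>) * Z \<omega> \<partial>M)
      = (\<integral>\<^sup>+ \<omega>. \<psi> (u \<omega>) * nn_cond_exp M (vimage_algebra (space M) u N) Z \<omega> \<partial>M)"
    by (rule nn_cond_exp_intg[symmetric]) fact
  also have "\<dots> \<le> (\<integral>\<^sup>+ \<omega>. \<psi> (u \<omega>) * c \<partial>M)"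
    using bound by (intro nn_integral_mono_AE) (auto elim!: eventually_mono intro: mult_left_mono)
  also have "\<dots> = (\<integral>\<^sup>+ \<omega>. \<psi> (u \<omega>) \<partial>M) * c"
    by (rule nn_integral_multc) measurable
  finally show ?thesis .
qed

lemma (in prob_space) square_integrable_of_nn_integral_le:
  fixes Z :: "'a \<Rightarrow> 'b :: euclidean_space"
  assumes [measurable]: "Z \<in> borel_measurable M"
    and le: "(\<integral>\<^sup>+ \<omega>. ennreal ((norm (Z \<omega>))\<^sup>2) \<partial>M) \<le> ennreal c" and c: "0 \<le> c"
  shows "integrable M (\<lambda>\<omega>. (norm (Z \<omega>))\<^sup>2)" "expectation (\<lambda>\<omega>. (norm (Z \<omega>))\<^sup>2) \<le> c"
    "integrable M Z"
proof -
  show sq: "integrable M (\<lambda>\<omega>. (norm (Z \<omega>))\<^sup>2)"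
    using le by (intro integrableI_bounded) (auto intro: le_less_trans)
  have "ennreal (expectation (\<lambda>\<omega>. (norm (Z \<omega>))\<^sup>2)) \<le> ennreal c"
    using le by (subst nn_integral_eq_integral[symmetric]) (auto simp: sq)
  then show "expectation (\<lambda>\<omega>. (norm (Z \<omega>))\<^sup>2) \<le> c"
    using c by (simp add: ennreal_le_iff)
  have "norm (Z \<omega>) \<le> norm (1 + (norm (Z \<omega>))\<^sup>2)" for \<omega>
    using zero_le_power2[of "norm (Z \<omega>) - 1"] by (simp add: power2_eq_square algebra_simps) (smt (verit) norm_ge_zero mult_nonneg_nonneg)
  then show "integrable M Z"
    by (intro Bochner_Integration.integrable_bound[of M "\<lambda>\<omega>. 1 + (norm (Z \<omega>))\<^sup>2" Z])
      (auto simp: sq)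
qed

text \<open>Young's inequality with a free weight. Later t is the averaging step size, so that the
  contraction of the average can compensate the factor 1 + t.\<close>

lemma norm_add_power2_le:
  fixes p q :: "'b :: real_inner"
  assumes "t > 0"
  shows "(norm (p + q))\<^sup>2 \<le> (1 + t) * (norm p)\<^sup>2 + (1 + 1 / t) * (norm q)\<^sup>2"
proof -
  have "0 \<le> (norm (t *\<^sub>R p - q))\<^sup>2 / t"
    using assms by simp
  also have "\<dots> = t * (norm p)\<^sup>2 + (norm q)\<^sup>2 / t - 2 * (p \<bullet> q)"
    using assms unfolding power2_norm_eq_inner
    by (simp add: inner_diff_left inner_diff_right inner_commute field_simps)
  finally show ?thesis
    unfolding power2_norm_eq_inner
    by (simp add: inner_add_left inner_add_right inner_commute algebra_simps)
qed

lemma norm_lin_comb_power2: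
  fixes p q :: "'b :: real_inner"
  shows "(norm (s *\<^sub>R p + t *\<^sub>R q))\<^sup>2 = s\<^sup>2 * (norm p)\<^sup>2 + 2 * s * t * (p \<bullet> q) + t\<^sup>2 * (norm q)\<^sup>2"
  unfolding power2_norm_eq_inner
  by (simp add: inner_add_left inner_add_right inner_commute power2_eq_square algebra_simps)

section \<open>One step from fixed points, with the sample of index 0\<close>

text \<open>The unconstrained problem, with a Lipschitz constant for the gradient of F as a separate
  parameter: a merely Lipschitz \<open>g\<close> need not make the composition with a smooth
  \<open>f\<close> smooth.\<close>

locale scgd_smooth = scgd_assumption M W V w v f fv g gw G UNIV C\<^sub>g C\<^sub>f V\<^sub>g L\<^sub>f
  for M :: "'a measure" and W :: "'w measure" and V :: "'v measure"
    and w :: "nat \<Rightarrow> 'a \<Rightarrow> 'w" and v :: "nat \<Rightarrow> 'a \<Rightarrow> 'v"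
    and f :: "real ^ 'm \<Rightarrow> real" and fv :: "'v \<Rightarrow> real ^ 'm \<Rightarrow> real"
    and g :: "real ^ 'n \<Rightarrow> real ^ 'm" and gw :: "'w \<Rightarrow> real ^ 'n \<Rightarrow> real ^ 'm"
    and G :: "'w \<Rightarrow> real ^ 'n \<Rightarrow> real ^ 'm ^ 'n"
    and C\<^sub>g C\<^sub>f V\<^sub>g L\<^sub>f :: real +
  fixes F :: "real ^ 'n \<Rightarrow> real" and L\<^sub>F :: real
  assumes F_def: "F = f \<circ> g"
    and F_differentiable: "\<And>z. F differentiable (at z)"
    and F_smooth: "L\<^sub>F-lipschitz_on UNIV (grad F)"
begin

lemma measurable_sample: "(\<lambda>\<omega>. (w k \<omega>, v k \<omega>)) \<in> measurable M (W \<Otimes>\<^sub>M V)"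
  using indep unfolding indep_vars_def by simp

lemma measurable_w [measurable]: "w k \<in> measurable M W"
  using measurable_comp[OF measurable_sample measurable_fst] by (simp add: comp_def)

lemma measurable_v [measurable]: "v k \<in> measurable M V"
  using measurable_comp[OF measurable_sample measurable_snd] by (simp add: comp_def)

lemma measurable_gw_compose [measurable (raw)]:
  "p \<in> measurable N W \<Longrightarrow> q \<in> borel_measurable N \<Longrightarrow> (\<lambda>\<omega>. gw (p \<omega>) (q \<omega>)) \<in> borel_measurable N"
  using measurable_compose[OF measurable_Pair measurable_gw, of p N q] by simp

lemma measurable_G_compose [measurable (raw)]:
  "p \<in> measurable N W \<Longrightarrow> q \<in> borel_measurable N \<Longrightarrow> (\<lambda>\<omega>. G (p \<omega>) (q \<omega>)) \<in> borel_measurable N"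
  using measurable_compose[OF measurable_Pair measurable_G, of p N q] by simp

lemma measurable_grad_fv_compose [measurable (raw)]:
  "p \<in> measurable N V \<Longrightarrow> q \<in> borel_measurable N \<Longrightarrow> (\<lambda>\<omega>. grad (fv (p \<omega>)) (q \<omega>)) \<in> borel_measurable N"
  using measurable_compose[OF measurable_Pair borel_measurable_grad[OF measurable_fv fv_differentiable], of p N q]
  by simp

lemma measurable_g [measurable]: "g \<in> borel_measurable borel"
  using continuous_g by (rule borel_measurable_continuous_onI)

lemma measurable_F [measurable]: "F \<in> borel_measurable borel"
  unfolding F_def using continuous_f continuous_g
  by (intro borel_measurable_continuous_onI continuous_on_compose) (auto intro: continuous_on_subset)

lemma measurable_grad_F [measurable]: "grad F \<in> borel_measurable borel"
  using lipschitz_on_continuous_on[OF F_smooth] by (rule borel_measurable_continuous_onI)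

lemma second_moment_G:
  "integrable M (\<lambda>\<omega>. (onorm ((*v) (G (w 0 \<omega>) x)))\<^sup>2)"
  "expectation (\<lambda>\<omega>. (onorm ((*v) (G (w 0 \<omega>) x)))\<^sup>2) \<le> C\<^sub>g"
  "(\<integral>\<^sup>+ \<omega>. ennreal ((onorm ((*v) (G (w 0 \<omega>) x)))\<^sup>2) \<partial>M) \<le> ennreal C\<^sub>g"
proof -
  have "(\<integral>\<^sup>+ \<omega>. 1 * ennreal ((onorm ((*v) (G (w 0 \<omega>) x)))\<^sup>2) \<partial>M) \<le> (\<integral>\<^sup>+ \<omega>. 1 \<partial>M) * ennreal C\<^sub>g"
    by (rule nn_integral_mult_le_of_nn_cond_exp_le[OF measurable_v _ _ G_second_moment]) measurable
  then show *: "(\<integral>\<^sup>+ \<omega>. ennreal ((onorm ((*v) (G (w 0 \<omega>) x)))\<^sup>2) \<partial>M) \<le> ennreal C\<^sub>g"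
    by (simp add: emeasure_space_1)
  then have "(\<integral>\<^sup>+ \<omega>. ennreal ((norm (onorm ((*v) (G (w 0 \<omega>) x))))\<^sup>2) \<partial>M) \<le> ennreal C\<^sub>g"
    by simp
  from square_integrable_of_nn_integral_le(1,2)[OF _ this]
  show "integrable M (\<lambda>\<omega>. (onorm ((*v) (G (w 0 \<omega>) x)))\<^sup>2)"
    "expectation (\<lambda>\<omega>. (onorm ((*v) (G (w 0 \<omega>) x)))\<^sup>2) \<le> C\<^sub>g"
    using positive by simp_all
qed

lemma variance_gw:
  "integrable M (\<lambda>\<omega>. (norm (gw (w 0 \<omega>) x - g x))\<^sup>2)"
  "expectation (\<lambda>\<omega>. (norm (gw (w 0 \<omega>) x - g x))\<^sup>2) \<le> V\<^sub>g"
proof -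
  have "(\<integral>\<^sup>+ \<omega>. 1 * ennreal ((norm (gw (w 0 \<omega>) x - g x))\<^sup>2) \<partial>M) \<le> (\<integral>\<^sup>+ \<omega>. 1 \<partial>M) * ennreal V\<^sub>g"
    by (rule nn_integral_mult_le_of_nn_cond_exp_le[OF measurable_v _ _ gw_variance]) measurable
  then have "(\<integral>\<^sup>+ \<omega>. ennreal ((norm (gw (w 0 \<omega>) x - g x))\<^sup>2) \<partial>M) \<le> ennreal V\<^sub>g"
    by (simp add: emeasure_space_1)
  from square_integrable_of_nn_integral_le(1,2)[OF _ this]
  show "integrable M (\<lambda>\<omega>. (norm (gw (w 0 \<omega>) x - g x))\<^sup>2)"
    "expectation (\<lambda>\<omega>. (norm (gw (w 0 \<omega>) x - g x))\<^sup>2) \<le> V\<^sub>g"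
    using positive by simp_all
qed

text \<open>The moment bound for \<open>\<nabla>f\<^sub>v\<close> is assumed at fixed points only. It carries over to a point
  \<open>h (w 0)\<close> depending on \<open>w 0\<close> by approximating \<open>h\<close> with simple functions and applying Fatou's
  lemma, as \<open>\<nabla>f\<^sub>v\<close> is continuous.\<close>

lemma second_moment_grad_fv:
  assumes h [measurable]: "h \<in> borel_measurable W" and \<psi> [measurable]: "\<psi> \<in> borel_measurable W"
    and finite: "\<And>u. \<psi> u < \<top>"
  shows "(\<integral>\<^sup>+ \<omega>. \<psi> (w 0 \<omega>) * ennreal ((norm (grad (fv (v 0 \<omega>)) (h (w 0 \<omega>))))\<^sup>2) \<partial>M)
      \<le> (\<integral>\<^sup>+ \<omega>. \<psi> (w 0 \<omega>) \<partial>M) * ennreal C\<^sub>f"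
proof -
  let ?\<phi> = "\<lambda>\<omega> z. ennreal ((norm (grad (fv (v 0 \<omega>)) z))\<^sup>2)"
  have const: "(\<integral>\<^sup>+ \<omega>. \<theta> (w 0 \<omega>) * ?\<phi> \<omega> z \<partial>M) \<le> (\<integral>\<^sup>+ \<omega>. \<theta> (w 0 \<omega>) \<partial>M) * ennreal C\<^sub>f"
    if [measurable]: "\<theta> \<in> borel_measurable W" for \<theta> z
    by (rule nn_integral_mult_le_of_nn_cond_exp_le[OF measurable_w _ _ fv_second_moment]) measurable
  have simple: "(\<integral>\<^sup>+ \<omega>. \<psi> (w 0 \<omega>) * ?\<phi> \<omega> (s (w 0 \<omega>)) \<partial>M) \<le> (\<integral>\<^sup>+ \<omega>. \<psi> (w 0 \<omega>) \<partial>M) * ennreal C\<^sub>f"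
    if s: "simple_function W s" for s
  proof -
    have fin: "finite (s ` space W)" using s by (rule simple_functionD)
    have [measurable]: "s -` {z} \<inter> space W \<in> sets W" for z
      using s by (rule simple_functionD)
    \<comment> \<open>Splitting the weight along the level sets of s reduces the claim to fixed
      points z, each with a weight that is still a function of \<open>w 0\<close>.\<close>
    define I where "I z u = \<psi> u * indicator (s -` {z} \<inter> space W) u" for z u
    have [measurable]: "I z \<in> borel_measurable W" for z unfolding I_def by measurable
    have I_sum: "(\<Sum>z\<in>s ` space W. I z u * c z) = \<psi> u * c (s u)" if u: "u \<in> space W" for u c
    proof -
      have "(\<Sum>z\<in>s ` space W. I z u * c z) = (\<Sum>z\<in>s ` space W. if z = s u then \<psi> u * c (s u) else 0)"
        using u by (intro sum.cong) (auto simp: I_def)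
      then show ?thesis using u fin by simp
    qed
    have "(\<integral>\<^sup>+ \<omega>. \<psi> (w 0 \<omega>) * ?\<phi> \<omega> (s (w 0 \<omega>)) \<partial>M)
        = (\<integral>\<^sup>+ \<omega>. (\<Sum>z\<in>s ` space W. I z (w 0 \<omega>) * ?\<phi> \<omega> z) \<partial>M)"
      by (intro nn_integral_cong) (simp add: I_sum measurable_space[OF measurable_w])
    also have "\<dots> = (\<Sum>z\<in>s ` space W. \<integral>\<^sup>+ \<omega>. I z (w 0 \<omega>) * ?\<phi> \<omega> z \<partial>M)"
      by (rule nn_integral_sum) measurable
    also have "\<dots> \<le> (\<Sum>z\<in>s ` space W. (\<integral>\<^sup>+ \<omega>. I z (w 0 \<omega>) \<partial>M) * ennreal C\<^sub>f)"
      by (intro sum_mono const) measurable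
    also have "\<dots> = (\<integral>\<^sup>+ \<omega>. (\<Sum>z\<in>s ` space W. I z (w 0 \<omega>)) \<partial>M) * ennreal C\<^sub>f"
      by (subst nn_integral_sum) (simp_all add: sum_distrib_right)
    also have "(\<integral>\<^sup>+ \<omega>. (\<Sum>z\<in>s ` space W. I z (w 0 \<omega>)) \<partial>M) = (\<integral>\<^sup>+ \<omega>. \<psi> (w 0 \<omega>) \<partial>M)"
      using I_sum[of _ "\<lambda>_. 1"]
      by (intro nn_integral_cong) (simp add: measurable_space[OF measurable_w])
    finally show ?thesis .
  qed
  obtain s where s: "\<And>i. simple_function W (s i)"
    and lim: "\<And>u. u \<in> space W \<Longrightarrow> (\<lambda>i. s i u) \<longlonglongrightarrow> h u"
    using borel_measurable_implies_sequence_metric[OF h, of 0] by blast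
  have [measurable]: "s i \<in> borel_measurable W" for i
    using s by (rule borel_measurable_simple_function)
  have "AE \<omega> in M. \<psi> (w 0 \<omega>) * ?\<phi> \<omega> (h (w 0 \<omega>))
      = liminf (\<lambda>i. \<psi> (w 0 \<omega>) * ?\<phi> \<omega> (s i (w 0 \<omega>)))"
    using fv_lipschitz_grad AE_space
  proof eventually_elim
    case (elim \<omega>)
    have "L\<^sub>f-lipschitz_on UNIV (grad (fv (v 0 \<omega>)))"
      using elim(1) positive by (intro lipschitz_onI) (auto simp: dist_norm)
    then have "continuous_on UNIV (grad (fv (v 0 \<omega>)))"
      by (rule lipschitz_on_continuous_on)
    moreover have "(\<lambda>i. s i (w 0 \<omega>)) \<longlonglongrightarrow> h (w 0 \<omega>)"
      using elim(2) by (intro lim) (rule measurable_space[OF measurable_w])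
    ultimately have "(\<lambda>i. grad (fv (v 0 \<omega>)) (s i (w 0 \<omega>))) \<longlonglongrightarrow> grad (fv (v 0 \<omega>)) (h (w 0 \<omega>))"
      by (rule continuous_on_tendsto_compose) auto
    then have "(\<lambda>i. ?\<phi> \<omega> (s i (w 0 \<omega>))) \<longlonglongrightarrow> ?\<phi> \<omega> (h (w 0 \<omega>))"
      by (intro tendsto_intros)
    \<comment> \<open>Finiteness of the weight matters here: multiplication by \<top> is not
      continuous at 0.\<close>
    then have "(\<lambda>i. \<psi> (w 0 \<omega>) * ?\<phi> \<omega> (s i (w 0 \<omega>))) \<longlonglongrightarrow> \<psi> (w 0 \<omega>) * ?\<phi> \<omega> (h (w 0 \<omega>))"
      by (intro ennreal_tendsto_cmult finite)
    then show ?case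
      by (rule lim_imp_Liminf[OF sequentially_bot, symmetric])
  qed
  then have "(\<integral>\<^sup>+ \<omega>. \<psi> (w 0 \<omega>) * ?\<phi> \<omega> (h (w 0 \<omega>)) \<partial>M)
      = (\<integral>\<^sup>+ \<omega>. liminf (\<lambda>i. \<psi> (w 0 \<omega>) * ?\<phi> \<omega> (s i (w 0 \<omega>))) \<partial>M)"
    by (rule nn_integral_cong_AE)
  also have "\<dots> \<le> liminf (\<lambda>i. \<integral>\<^sup>+ \<omega>. \<psi> (w 0 \<omega>) * ?\<phi> \<omega> (s i (w 0 \<omega>)) \<partial>M)"
    by (rule nn_integral_liminf) measurable
  also have "\<dots> \<le> liminf (\<lambda>i. (\<integral>\<^sup>+ \<omega>. \<psi> (w 0 \<omega>) \<partial>M) * ennreal C\<^sub>f)"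
    using simple[OF s] by (intro Liminf_mono) auto
  finally show ?thesis by (simp add: Liminf_const)
qed

text \<open>With the squared operator norm of \<open>G\<close> as a weight depending on
  \<open>w 0\<close>, conditioning on \<open>w 0\<close> bounds the moment of the product by the
  product of the bounds, although \<open>w 0\<close> and \<open>v 0\<close> may be dependent. The
  point of evaluation may depend on \<open>w 0\<close> because the updated average does.\<close>

lemma second_moment_direction:
  fixes x :: "real ^ 'n"
  assumes h [measurable]: "h \<in> borel_measurable W"
  defines "Z \<equiv> \<lambda>\<omega>. G (w 0 \<omega>) x *v grad (fv (v 0 \<omega>)) (h (w 0 \<omega>))"
  shows "integrable M (\<lambda>\<omega>. (norm (Z \<omega>))\<^sup>2)" "expectation (\<lambda>\<omega>. (norm (Z \<omega>))\<^sup>2) \<le> C\<^sub>g * C\<^sub>f"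
    "integrable M Z"
proof -
  have [measurable]: "Z \<in> borel_measurable M" unfolding Z_def by measurable
  have "(\<integral>\<^sup>+ \<omega>. ennreal ((norm (Z \<omega>))\<^sup>2) \<partial>M)
      \<le> (\<integral>\<^sup>+ \<omega>. ennreal ((onorm ((*v) (G (w 0 \<omega>) x)))\<^sup>2) *
          ennreal ((norm (grad (fv (v 0 \<omega>)) (h (w 0 \<omega>))))\<^sup>2) \<partial>M)"
  proof (rule nn_integral_mono)
    fix \<omega>
    have "(norm (Z \<omega>))\<^sup>2 \<le> (onorm ((*v) (G (w 0 \<omega>) x)) * norm (grad (fv (v 0 \<omega>)) (h (w 0 \<omega>))))\<^sup>2"
      unfolding Z_def by (intro power_mono norm_matrix_mult_le norm_ge_zero)
    then show "ennreal ((norm (Z \<omega>))\<^sup>2) \<le> ennreal ((onorm ((*v) (G (w 0 \<omega>) x)))\<^sup>2) *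
        ennreal ((norm (grad (fv (v 0 \<omega>)) (h (w 0 \<omega>))))\<^sup>2)"
      by (subst ennreal_mult'[symmetric]) (simp_all add: power_mult_distrib ennreal_leI)
  qed
  also have "\<dots> \<le> (\<integral>\<^sup>+ \<omega>. ennreal ((onorm ((*v) (G (w 0 \<omega>) x)))\<^sup>2) \<partial>M) * ennreal C\<^sub>f"
  proof (rule second_moment_grad_fv[OF h, where \<psi> = "\<lambda>u. ennreal ((onorm ((*v) (G u x)))\<^sup>2)"])
    show "(\<lambda>u. ennreal ((onorm ((*v) (G u x)))\<^sup>2)) \<in> borel_measurable W"
      by measurable
  qed simp
  also have "\<dots> \<le> ennreal C\<^sub>g * ennreal C\<^sub>f"
    by (intro mult_right_mono second_moment_G) simp
  also have "\<dots> = ennreal (C\<^sub>g * C\<^sub>f)"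
    using positive by (simp add: ennreal_mult')
  finally have *: "(\<integral>\<^sup>+ \<omega>. ennreal ((norm (Z \<omega>))\<^sup>2) \<partial>M) \<le> ennreal (C\<^sub>g * C\<^sub>f)" .
  have "0 \<le> C\<^sub>g * C\<^sub>f" using positive by simp
  from square_integrable_of_nn_integral_le[OF \<open>Z \<in> borel_measurable M\<close> * this]
  show "integrable M (\<lambda>\<omega>. (norm (Z \<omega>))\<^sup>2)" "expectation (\<lambda>\<omega>. (norm (Z \<omega>))\<^sup>2) \<le> C\<^sub>g * C\<^sub>f"
    "integrable M Z"
    by blast+
qed

text \<open>The tower property. As F is differentiable, the subdifferential in the unbiasedness
  condition is a single point and membership becomes an equation. The integrability that gives the
  componentwise conditional expectation its meaning comes from the second moment of the
  direction.\<close>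

lemma expectation_gradient:
  "expectation (\<lambda>\<omega>. G (w 0 \<omega>) x *v grad (fv (v 0 \<omega>)) (g x)) = grad F x"
proof -
  define Z where "Z \<omega> = G (w 0 \<omega>) x *v grad (fv (v 0 \<omega>)) (g x)" for \<omega>
  have int: "integrable M Z"
    unfolding Z_def using second_moment_direction(3)[of "\<lambda>_. g x"] by simp
  let ?A = "vimage_algebra (space M) (v 0) V"
  interpret finite_measure_subalgebra M ?A
    using finite_measure_axioms measurable_v by (rule finite_measure_subalgebra_vimage_algebra)
  have "expectation Z $ i = grad F x $ i" for i
  proof -
    have "AE \<omega> in M. vec_cond_exp M ?A Z \<omega> \<in> {grad F x}"
      using gradient_unbiased[of x] F_differentiable[of x]
      unfolding Z_def F_def subdiff_def by simp
    then have "AE \<omega> in M. real_cond_exp M ?A (\<lambda>\<omega>. Z \<omega> $ i) \<omega> = grad F x $ i"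
      by eventually_elim (simp add: vec_cond_exp_def vec_eq_iff)
    then have "expectation (real_cond_exp M ?A (\<lambda>\<omega>. Z \<omega> $ i)) = expectation (\<lambda>_. grad F x $ i)"
      by (intro integral_cong_AE) auto
    moreover have "expectation (real_cond_exp M ?A (\<lambda>\<omega>. Z \<omega> $ i)) = expectation (\<lambda>\<omega>. Z \<omega> $ i)"
      using int by (intro real_cond_exp_int integrable_bounded_linear[OF bounded_linear_vec_nth])
    moreover have "expectation (\<lambda>\<omega>. Z \<omega> $ i) = expectation Z $ i"
      using int by (intro integral_bounded_linear[OF bounded_linear_vec_nth])
    ultimately show ?thesis by (simp add: prob_space)
  qed
  then show ?thesis unfolding Z_def by (simp add: vec_eq_iff)
qed

text \<open>The comparison direction \<open>Z0\<close>, evaluated at the exact inner value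
  \<open>g x\<close>, has mean \<open>grad F x\<close>; its distance to \<open>Z\<close> is
  controlled by the Lipschitz gradient of \<open>fv\<close>. The nonnegative integral on the left
  avoids claiming integrability of the new objective value, while the integrable majorant
  \<open>B\<close> permits computing with ordinary expectations.\<close>

lemma one_step_objective:
  fixes x :: "real ^ 'n" and y :: "real ^ 'm"
  assumes \<alpha>: "0 \<le> \<alpha>" and \<beta>: "0 \<le> \<beta>" "\<beta> \<le> 1" and lower: "\<And>z. Fmin \<le> F z"
  defines "Y \<equiv> \<lambda>\<omega>. (1 - \<beta>) *\<^sub>R y + \<beta> *\<^sub>R gw (w 0 \<omega>) x"
  defines "Z \<equiv> \<lambda>\<omega>. G (w 0 \<omega>) x *v grad (fv (v 0 \<omega>)) (Y \<omega>)"
  shows "(\<integral>\<^sup>+ \<omega>. ennreal (F (x - \<alpha> *\<^sub>R Z \<omega>) - Fmin) \<partial>M) + ennreal (\<alpha> / 2 * (norm (grad F x))\<^sup>2)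
    \<le> ennreal (F x - Fmin + (L\<^sub>f * (1 + C\<^sub>g) / 2)\<^sup>2 * \<alpha> * (norm (y - g x))\<^sup>2
        + ((L\<^sub>f * (C\<^sub>g + V\<^sub>g) / 2)\<^sup>2 * \<alpha> * \<beta>\<^sup>2 + L\<^sub>F * C\<^sub>g * C\<^sub>f * \<alpha>\<^sup>2))"
proof -
  let ?d = "norm (y - g x)" and ?N = "norm (grad F x)"
  let ?P = "L\<^sub>f * (1 + C\<^sub>g) / 2" and ?Q = "L\<^sub>f * (C\<^sub>g + V\<^sub>g) / 2"
  define o' where "o' \<omega> = onorm ((*v) (G (w 0 \<omega>) x))" for \<omega>
  define n where "n \<omega> = norm (gw (w 0 \<omega>) x - g x)" for \<omega>
  define Z0 where "Z0 \<omega> = G (w 0 \<omega>) x *v grad (fv (v 0 \<omega>)) (g x)" for \<omega>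
  have LF: "0 \<le> L\<^sub>F" using F_smooth by (rule lipschitz_on_nonneg)
  have Z: "integrable M (\<lambda>\<omega>. (norm (Z \<omega>))\<^sup>2)" "expectation (\<lambda>\<omega>. (norm (Z \<omega>))\<^sup>2) \<le> C\<^sub>g * C\<^sub>f"
    unfolding Z_def Y_def
    using second_moment_direction[of "\<lambda>u. (1 - \<beta>) *\<^sub>R y + \<beta> *\<^sub>R gw u x" x] by simp_all
  have Z0: "integrable M Z0" "expectation Z0 = grad F x"
    unfolding Z0_def using second_moment_direction(3)[of "\<lambda>_. g x" x] expectation_gradient by simp_all
  have o': "integrable M (\<lambda>\<omega>. (o' \<omega>)\<^sup>2)" "expectation (\<lambda>\<omega>. (o' \<omega>)\<^sup>2) \<le> C\<^sub>g"
    unfolding o'_def by (rule second_moment_G)+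
  have n: "integrable M (\<lambda>\<omega>. (n \<omega>)\<^sup>2)" "expectation (\<lambda>\<omega>. (n \<omega>)\<^sup>2) \<le> V\<^sub>g"
    unfolding n_def by (rule variance_gw)+
  have o'_nonneg: "0 \<le> o' \<omega>" and n_nonneg: "0 \<le> n \<omega>" for \<omega>
    unfolding o'_def n_def by (simp_all add: onorm_pos_le matrix_vector_mul_bounded_linear)
  define B where "B \<omega> = F x - Fmin - \<alpha> * (grad F x \<bullet> Z0 \<omega>)
      + \<alpha> * ?N * L\<^sub>f * ((1 + (o' \<omega>)\<^sup>2) / 2 * ?d + \<beta> * (((o' \<omega>)\<^sup>2 + (n \<omega>)\<^sup>2) / 2))
      + L\<^sub>F * \<alpha>\<^sup>2 * (norm (Z \<omega>))\<^sup>2" for \<omega>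
  have B_int: "integrable M B"
    unfolding B_def using Z Z0 o' n
    by (intro Bochner_Integration.integrable_add Bochner_Integration.integrable_diff
        integrable_mult_right integrable_mult_left integrable_divide integrable_inner_right integrable_const) auto
  have pointwise: "AE \<omega> in M. F (x - \<alpha> *\<^sub>R Z \<omega>) - Fmin \<le> B \<omega>"
    using fv_lipschitz_grad
  proof eventually_elim
    case (elim \<omega>)
    have "norm (Y \<omega> - g x) = norm ((1 - \<beta>) *\<^sub>R (y - g x) + \<beta> *\<^sub>R (gw (w 0 \<omega>) x - g x))"
      by (simp add: Y_def algebra_simps)
    also have "\<dots> \<le> (1 - \<beta>) * ?d + \<beta> * n \<omega>"
      using \<beta> by (intro norm_triangle_le) (simp add: n_def)
    also have "\<dots> \<le> ?d + \<beta> * n \<omega>"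
      using \<beta> by (simp add: algebra_simps)
    finally have Y: "norm (Y \<omega> - g x) \<le> ?d + \<beta> * n \<omega>" .
    have "norm (Z \<omega> - Z0 \<omega>) = norm (G (w 0 \<omega>) x *v (grad (fv (v 0 \<omega>)) (Y \<omega>) - grad (fv (v 0 \<omega>)) (g x)))"
      unfolding Z_def Z0_def by (simp add: matrix_vector_mult_diff_distrib)
    also have "\<dots> \<le> o' \<omega> * norm (grad (fv (v 0 \<omega>)) (Y \<omega>) - grad (fv (v 0 \<omega>)) (g x))"
      unfolding o'_def by (rule norm_matrix_mult_le)
    also have "\<dots> \<le> o' \<omega> * (L\<^sub>f * norm (Y \<omega> - g x))"
      using elim o'_nonneg by (intro mult_left_mono) auto
    also have "\<dots> \<le> o' \<omega> * (L\<^sub>f * (?d + \<beta> * n \<omega>))"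
      using Y positive o'_nonneg by (intro mult_left_mono) auto
    also have "\<dots> = L\<^sub>f * (o' \<omega> * ?d + \<beta> * (o' \<omega> * n \<omega>))"
      by (simp add: algebra_simps)
    \<comment> \<open>Only second moments are available, so first powers and mixed products are
      traded for squares. This is the origin of the constants (1 + \<open>C\<^sub>g\<close>) / 2 and
      (\<open>C\<^sub>g\<close> + \<open>V\<^sub>g\<close>) / 2.\<close>
    also have "\<dots> \<le> L\<^sub>f * ((1 + (o' \<omega>)\<^sup>2) / 2 * ?d + \<beta> * (((o' \<omega>)\<^sup>2 + (n \<omega>)\<^sup>2) / 2))"
    proof -
      have "o' \<omega> \<le> (1 + (o' \<omega>)\<^sup>2) / 2"
        using zero_le_power2[of "o' \<omega> - 1"] by (simp add: power2_eq_square algebra_simps)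
      moreover have "o' \<omega> * n \<omega> \<le> ((o' \<omega>)\<^sup>2 + (n \<omega>)\<^sup>2) / 2"
        using zero_le_power2[of "o' \<omega> - n \<omega>"] by (simp add: power2_eq_square algebra_simps)
      ultimately show ?thesis
        using positive \<beta> by (intro mult_left_mono add_mono mult_right_mono) auto
    qed
    finally have diff: "norm (Z \<omega> - Z0 \<omega>)
      \<le> L\<^sub>f * ((1 + (o' \<omega>)\<^sup>2) / 2 * ?d + \<beta> * (((o' \<omega>)\<^sup>2 + (n \<omega>)\<^sup>2) / 2))" (is "_ \<le> ?D") .
    have "- (grad F x \<bullet> Z \<omega>) = - (grad F x \<bullet> Z0 \<omega>) + - (grad F x \<bullet> (Z \<omega> - Z0 \<omega>))"
      by (simp add: inner_diff_right)
    also have "- (grad F x \<bullet> (Z \<omega> - Z0 \<omega>)) \<le> ?N * norm (Z \<omega> - Z0 \<omega>)"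
      using Cauchy_Schwarz_ineq2[of "grad F x" "Z \<omega> - Z0 \<omega>"] by linarith
    also have "\<dots> \<le> ?N * ?D"
      using diff by (intro mult_left_mono) auto
    finally have inner: "- (grad F x \<bullet> Z \<omega>) \<le> - (grad F x \<bullet> Z0 \<omega>) + ?N * ?D" by simp
    have "F (x - \<alpha> *\<^sub>R Z \<omega>) \<le> F x + \<alpha> * - (grad F x \<bullet> Z \<omega>) + L\<^sub>F * \<alpha>\<^sup>2 * (norm (Z \<omega>))\<^sup>2"
      using descent_lemma[OF F_differentiable F_smooth, of "x - \<alpha> *\<^sub>R Z \<omega>" x]
      by (simp add: power_mult_distrib mult.assoc)
    also have "\<dots> \<le> F x + \<alpha> * (- (grad F x \<bullet> Z0 \<omega>) + ?N * ?D) + L\<^sub>F * \<alpha>\<^sup>2 * (norm (Z \<omega>))\<^sup>2"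
      using inner \<alpha> LF by (intro add_mono mult_left_mono) auto
    also have "\<dots> = B \<omega> + Fmin"
    proof -
      have "a + \<alpha> * (- i + N * (l * X)) + t = a - m - \<alpha> * i + \<alpha> * N * l * X + t + m"
        for a i N l X t m :: real
        by (simp add: algebra_simps)
      then show ?thesis unfolding B_def .
    qed
    finally show ?case by simp
  qed
  have B_nonneg: "AE \<omega> in M. 0 \<le> B \<omega>"
    using pointwise
  proof eventually_elim
    case (elim \<omega>)
    then show ?case using lower[of "x - \<alpha> *\<^sub>R Z \<omega>"] by linarith
  qed
  have "expectation B = F x - Fmin - \<alpha> * (grad F x \<bullet> expectation Z0)
      + \<alpha> * ?N * L\<^sub>f * ((1 + expectation (\<lambda>\<omega>. (o' \<omega>)\<^sup>2)) / 2 * ?d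
        + \<beta> * ((expectation (\<lambda>\<omega>. (o' \<omega>)\<^sup>2) + expectation (\<lambda>\<omega>. (n \<omega>)\<^sup>2)) / 2))
      + L\<^sub>F * \<alpha>\<^sup>2 * expectation (\<lambda>\<omega>. (norm (Z \<omega>))\<^sup>2)"
    unfolding B_def using Z(1) Z0(1) o'(1) n(1) by (simp add: prob_space)
  also have "\<dots> \<le> F x - Fmin - \<alpha> * (grad F x \<bullet> grad F x)
      + \<alpha> * ?N * L\<^sub>f * ((1 + C\<^sub>g) / 2 * ?d + \<beta> * ((C\<^sub>g + V\<^sub>g) / 2)) + L\<^sub>F * \<alpha>\<^sup>2 * (C\<^sub>g * C\<^sub>f)"
    unfolding Z0(2) using Z(2) o'(2) n(2) \<alpha> \<beta> positive LF
    by (intro add_mono mult_left_mono mult_right_mono divide_right_mono diff_mono order_refl) auto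
  also have "\<dots> = F x - Fmin - \<alpha> * ?N\<^sup>2 + \<alpha> * (?N * (?P * ?d + ?Q * \<beta>)) + L\<^sub>F * C\<^sub>g * C\<^sub>f * \<alpha>\<^sup>2"
    by (simp add: power2_norm_eq_inner field_simps)
  also have "\<dots> \<le> F x - Fmin - \<alpha> * ?N\<^sup>2 + \<alpha> * (?N\<^sup>2 / 2 + (?P\<^sup>2 * ?d\<^sup>2 + ?Q\<^sup>2 * \<beta>\<^sup>2)) + L\<^sub>F * C\<^sub>g * C\<^sub>f * \<alpha>\<^sup>2"
  proof -
    \<comment> \<open>Half of the squared gradient is spent on the bias of the direction; the other
      half remains as the guaranteed decrease.\<close>
    have "N * (p + q) \<le> N\<^sup>2 / 2 + (p\<^sup>2 + q\<^sup>2)" for N p q :: real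
      using zero_le_power2[of "N - (p + q)"] zero_le_power2[of "p - q"]
      by (simp add: power2_eq_square algebra_simps)
    from this[of ?N "?P * ?d" "?Q * \<beta>"] show ?thesis
      using \<alpha> by (intro add_mono mult_left_mono order_refl) (simp_all only: power_mult_distrib)
  qed
  also have "\<dots> = F x - Fmin + ?P\<^sup>2 * \<alpha> * ?d\<^sup>2 + (?Q\<^sup>2 * \<alpha> * \<beta>\<^sup>2 + L\<^sub>F * C\<^sub>g * C\<^sub>f * \<alpha>\<^sup>2) - \<alpha> / 2 * ?N\<^sup>2"
    by (simp add: algebra_simps)
  finally have EB: "expectation B + \<alpha> / 2 * ?N\<^sup>2
      \<le> F x - Fmin + ?P\<^sup>2 * \<alpha> * ?d\<^sup>2 + (?Q\<^sup>2 * \<alpha> * \<beta>\<^sup>2 + L\<^sub>F * C\<^sub>g * C\<^sub>f * \<alpha>\<^sup>2)" by simp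
  have "(\<integral>\<^sup>+ \<omega>. ennreal (F (x - \<alpha> *\<^sub>R Z \<omega>) - Fmin) \<partial>M) \<le> (\<integral>\<^sup>+ \<omega>. ennreal (B \<omega>) \<partial>M)"
    using pointwise by (intro nn_integral_mono_AE) (auto elim!: eventually_mono intro: ennreal_leI)
  also have "\<dots> = ennreal (expectation B)"
    using B_int B_nonneg by (rule nn_integral_eq_integral)
  finally have "(\<integral>\<^sup>+ \<omega>. ennreal (F (x - \<alpha> *\<^sub>R Z \<omega>) - Fmin) \<partial>M) + ennreal (\<alpha> / 2 * ?N\<^sup>2)
      \<le> ennreal (expectation B) + ennreal (\<alpha> / 2 * ?N\<^sup>2)"
    by (rule add_right_mono)
  also have "\<dots> = ennreal (expectation B + \<alpha> / 2 * ?N\<^sup>2)"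
    using \<alpha> integral_nonneg_AE[OF B_nonneg] by (simp add: ennreal_plus)
  also note ennreal_leI[OF EB]
  finally show ?thesis .
qed

text \<open>The sampling noise is centered, so its cross term with the old error vanishes in the
  mean. The displacement of \<open>g\<close> may be correlated with that noise, both coming from the
  same sample; it is split off by Young's inequality instead, at the price of a factor of order 1 /
  \<beta>.\<close>

lemma one_step_tracking:
  fixes x :: "real ^ 'n" and y :: "real ^ 'm"
  assumes \<beta>: "0 < \<beta>" "\<beta> \<le> 1"
  defines "Y \<equiv> \<lambda>\<omega>. (1 - \<beta>) *\<^sub>R y + \<beta> *\<^sub>R gw (w 0 \<omega>) x"
  defines "Z \<equiv> \<lambda>\<omega>. G (w 0 \<omega>) x *v grad (fv (v 0 \<omega>)) (Y \<omega>)"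
  shows "(\<integral>\<^sup>+ \<omega>. ennreal ((norm (Y \<omega> - g (x - \<alpha> *\<^sub>R Z \<omega>)))\<^sup>2) \<partial>M)
    \<le> ennreal ((1 - \<beta>) * (norm (y - g x))\<^sup>2 + (2 * V\<^sub>g * \<beta>\<^sup>2 + 2 * C\<^sub>g ^ 3 * C\<^sub>f * (\<alpha>\<^sup>2 / \<beta>)))"
proof -
  let ?d = "y - g x"
  define n where "n \<omega> = gw (w 0 \<omega>) x - g x" for \<omega>
  have Z: "integrable M (\<lambda>\<omega>. (norm (Z \<omega>))\<^sup>2)" "expectation (\<lambda>\<omega>. (norm (Z \<omega>))\<^sup>2) \<le> C\<^sub>g * C\<^sub>f"
    unfolding Z_def Y_def
    using second_moment_direction[of "\<lambda>u. (1 - \<beta>) *\<^sub>R y + \<beta> *\<^sub>R gw u x" x] by simp_all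
  have n2: "integrable M (\<lambda>\<omega>. (norm (n \<omega>))\<^sup>2)" "expectation (\<lambda>\<omega>. (norm (n \<omega>))\<^sup>2) \<le> V\<^sub>g"
    unfolding n_def by (rule variance_gw)+
  have n: "integrable M n" "expectation n = 0"
    unfolding n_def using integrable_gw[of x] g_eq[of x] by (simp_all add: prob_space)
  define B where "B \<omega> = (1 + \<beta>) * ((1 - \<beta>)\<^sup>2 * (norm ?d)\<^sup>2 + 2 * (1 - \<beta>) * \<beta> * (?d \<bullet> n \<omega>) + \<beta>\<^sup>2 * (norm (n \<omega>))\<^sup>2)
      + (1 + 1 / \<beta>) * (C\<^sub>g\<^sup>2 * \<alpha>\<^sup>2 * (norm (Z \<omega>))\<^sup>2)" for \<omega>
  have B_int: "integrable M B"
    unfolding B_def using Z n n2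
    by (intro Bochner_Integration.integrable_add integrable_mult_right integrable_inner_right integrable_const) auto
  have pointwise: "(norm (Y \<omega> - g (x - \<alpha> *\<^sub>R Z \<omega>)))\<^sup>2 \<le> B \<omega>" for \<omega>
  proof -
    let ?p = "(1 - \<beta>) *\<^sub>R ?d + \<beta> *\<^sub>R n \<omega>" and ?q = "g x - g (x - \<alpha> *\<^sub>R Z \<omega>)"
    have "Y \<omega> - g (x - \<alpha> *\<^sub>R Z \<omega>) = ?p + ?q"
      by (simp add: Y_def n_def algebra_simps)
    then have "(norm (Y \<omega> - g (x - \<alpha> *\<^sub>R Z \<omega>)))\<^sup>2 \<le> (1 + \<beta>) * (norm ?p)\<^sup>2 + (1 + 1 / \<beta>) * (norm ?q)\<^sup>2"
      by (simp only: norm_add_power2_le[OF \<beta>(1)])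
    moreover have "(norm ?p)\<^sup>2 = (1 - \<beta>)\<^sup>2 * (norm ?d)\<^sup>2 + 2 * (1 - \<beta>) * \<beta> * (?d \<bullet> n \<omega>) + \<beta>\<^sup>2 * (norm (n \<omega>))\<^sup>2"
      by (simp only: norm_lin_comb_power2)
    moreover have "norm ?q \<le> C\<^sub>g * norm (\<alpha> *\<^sub>R Z \<omega>)"
      using lipschitz_onD[OF g_lipschitz, of x "x - \<alpha> *\<^sub>R Z \<omega>"] by (simp add: dist_norm)
    then have "(norm ?q)\<^sup>2 \<le> (C\<^sub>g * norm (\<alpha> *\<^sub>R Z \<omega>))\<^sup>2"
      by (intro power_mono) auto
    then have "(norm ?q)\<^sup>2 \<le> C\<^sub>g\<^sup>2 * \<alpha>\<^sup>2 * (norm (Z \<omega>))\<^sup>2"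
      by (simp add: power_mult_distrib mult.assoc)
    then have "(1 + 1 / \<beta>) * (norm ?q)\<^sup>2 \<le> (1 + 1 / \<beta>) * (C\<^sub>g\<^sup>2 * \<alpha>\<^sup>2 * (norm (Z \<omega>))\<^sup>2)"
      using \<beta> by (intro mult_left_mono) auto
    ultimately show ?thesis unfolding B_def by simp
  qed
  have B_nonneg: "0 \<le> B \<omega>" for \<omega>
    using pointwise by (rule order_trans[rotated]) simp
  have "expectation B = (1 + \<beta>) * ((1 - \<beta>)\<^sup>2 * (norm ?d)\<^sup>2 + 2 * (1 - \<beta>) * \<beta> * (?d \<bullet> expectation n)
        + \<beta>\<^sup>2 * expectation (\<lambda>\<omega>. (norm (n \<omega>))\<^sup>2))
      + (1 + 1 / \<beta>) * (C\<^sub>g\<^sup>2 * \<alpha>\<^sup>2 * expectation (\<lambda>\<omega>. (norm (Z \<omega>))\<^sup>2))"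
    unfolding B_def using Z(1) n(1) n2(1) by (simp add: prob_space)
  also have "\<dots> \<le> (1 + \<beta>) * ((1 - \<beta>)\<^sup>2 * (norm ?d)\<^sup>2 + 0 + \<beta>\<^sup>2 * V\<^sub>g)
      + (1 + 1 / \<beta>) * (C\<^sub>g\<^sup>2 * \<alpha>\<^sup>2 * (C\<^sub>g * C\<^sub>f))"
    unfolding n(2) using Z(2) n2(2) \<beta> positive
    by (intro add_mono mult_left_mono order_refl) auto
  also have "\<dots> = ((1 + \<beta>) * (1 - \<beta>)) * ((1 - \<beta>) * (norm ?d)\<^sup>2) + (1 + \<beta>) * (\<beta>\<^sup>2 * V\<^sub>g)
      + (1 + 1 / \<beta>) * (C\<^sub>g ^ 3 * C\<^sub>f * \<alpha>\<^sup>2)"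
    by (simp add: power2_eq_square power3_eq_cube algebra_simps)
  also have "\<dots> \<le> 1 * ((1 - \<beta>) * (norm ?d)\<^sup>2) + 2 * (\<beta>\<^sup>2 * V\<^sub>g) + (2 / \<beta>) * (C\<^sub>g ^ 3 * C\<^sub>f * \<alpha>\<^sup>2)"
  proof (intro add_mono mult_right_mono)
    \<comment> \<open>One of the two factors 1 - \<beta> pays for the Young factor 1 + \<beta>; the
      other one is the contraction that survives.\<close>
    show "(1 + \<beta>) * (1 - \<beta>) \<le> 1" by (simp add: algebra_simps)
    show "1 + 1 / \<beta> \<le> 2 / \<beta>" using \<beta> by (simp add: field_simps)
  qed (use \<beta> positive in auto)
  also have "\<dots> = (1 - \<beta>) * (norm ?d)\<^sup>2 + (2 * V\<^sub>g * \<beta>\<^sup>2 + 2 * C\<^sub>g ^ 3 * C\<^sub>f * (\<alpha>\<^sup>2 / \<beta>))"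
    by simp
  finally have EB: "expectation B \<le> (1 - \<beta>) * (norm ?d)\<^sup>2 + (2 * V\<^sub>g * \<beta>\<^sup>2 + 2 * C\<^sub>g ^ 3 * C\<^sub>f * (\<alpha>\<^sup>2 / \<beta>))" .
  have "(\<integral>\<^sup>+ \<omega>. ennreal ((norm (Y \<omega> - g (x - \<alpha> *\<^sub>R Z \<omega>)))\<^sup>2) \<partial>M) \<le> (\<integral>\<^sup>+ \<omega>. ennreal (B \<omega>) \<partial>M)"
    using pointwise by (intro nn_integral_mono ennreal_leI)
  also have "\<dots> = ennreal (expectation B)"
    using B_int B_nonneg by (intro nn_integral_eq_integral) auto
  also note ennreal_leI[OF EB]
  finally show ?thesis .
qed

section \<open>Iterates as functions of the samples\<close>

definition step :: "real \<Rightarrow> real \<Rightarrow> (real ^ 'n) \<times> (real ^ 'm) \<Rightarrow> 'w \<times> 'v \<Rightarrow> (real ^ 'n) \<times> (real ^ 'm)" where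
  "step a b s \<xi> = (let y' = (1 - b) *\<^sub>R snd s + b *\<^sub>R gw (fst \<xi>) (fst s)
    in (fst s - a *\<^sub>R (G (fst \<xi>) (fst s) *v grad (fv (snd \<xi>)) y'), y'))"

text \<open>Running the algorithm on an arbitrary sequence of samples separates the recursion from
  the randomness: that iterate k depends on the first k samples only becomes a property of a
  deterministic function.\<close>

primrec trajectory :: "(nat \<Rightarrow> real) \<Rightarrow> (nat \<Rightarrow> real) \<Rightarrow> (real ^ 'n) \<times> (real ^ 'm) \<Rightarrow> (nat \<Rightarrow> 'w \<times> 'v) \<Rightarrow> nat \<Rightarrow>
    (real ^ 'n) \<times> (real ^ 'm)" where
  "trajectory \<alpha> \<beta> s \<xi> 0 = s"
| "trajectory \<alpha> \<beta> s \<xi> (Suc k) = step (\<alpha> k) (\<beta> k) (trajectory \<alpha> \<beta> s \<xi> k) (\<xi> k)"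

lemma measurable_step:
  "(\<lambda>(s, \<xi>). step a b s \<xi>) \<in> measurable ((borel \<Otimes>\<^sub>M borel) \<Otimes>\<^sub>M (W \<Otimes>\<^sub>M V)) (borel \<Otimes>\<^sub>M borel)"
  unfolding step_def Let_def by measurable

lemma measurable_step_compose [measurable (raw)]:
  assumes "p \<in> measurable N (borel \<Otimes>\<^sub>M borel)" "q \<in> measurable N (W \<Otimes>\<^sub>M V)"
  shows "(\<lambda>\<omega>. step a b (p \<omega>) (q \<omega>)) \<in> measurable N (borel \<Otimes>\<^sub>M borel)"
  using measurable_compose[OF measurable_Pair[OF assms] measurable_step[of a b]] by simp

text \<open>Allowing any index set that contains the first k indices keeps the product space fixed
  throughout the induction.\<close>

lemma measurable_trajectory:
  "{..<k} \<subseteq> I \<Longrightarrow>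
    (\<lambda>\<xi>. trajectory \<alpha> \<beta> s \<xi> k) \<in> measurable (Pi\<^sub>M I (\<lambda>_. W \<Otimes>\<^sub>M V)) (borel \<Otimes>\<^sub>M borel)"
proof (induction k)
  case 0
  have "s \<in> space (borel \<Otimes>\<^sub>M borel)" by (simp add: space_pair_measure)
  then show ?case by simp
next
  case (Suc k)
  then have k: "{..<k} \<subseteq> I" "k \<in> I" by auto
  note Suc.IH[OF k(1), measurable] measurable_component_singleton[OF k(2), measurable]
  show ?case by simp measurable
qed

lemma trajectory_cong: "(\<And>i. i < k \<Longrightarrow> \<xi> i = \<xi>' i) \<Longrightarrow> trajectory \<alpha> \<beta> s \<xi> k = trajectory \<alpha> \<beta> s \<xi>' k"
  by (induction k) auto

lemma iterates_eq_trajectory: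
  assumes iter: "scgd_iterates M w v fv gw G UNIV \<alpha> \<beta> x0 y0 x y" and \<omega>: "\<omega> \<in> space M"
  shows "(x k \<omega>, y k \<omega>) = trajectory \<alpha> \<beta> (x0, y0) (\<lambda>i. (w i \<omega>, v i \<omega>)) k"
proof (induction k)
  case 0
  show ?case using assms by (simp add: scgd_iterates_def)
next
  case (Suc k)
  have "y (Suc k) \<omega> = (1 - \<beta> k) *\<^sub>R y k \<omega> + \<beta> k *\<^sub>R gw (w k \<omega>) (x k \<omega>)"
    and "x (Suc k) \<omega> = x k \<omega> - \<alpha> k *\<^sub>R (G (w k \<omega>) (x k \<omega>) *v grad (fv (v k \<omega>)) (y (Suc k) \<omega>))"
    using assms by (simp_all add: scgd_iterates_def closest_point_self)
  then have "(x (Suc k) \<omega>, y (Suc k) \<omega>) = step (\<alpha> k) (\<beta> k) (x k \<omega>, y k \<omega>) (w k \<omega>, v k \<omega>)"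
    by (simp add: step_def Let_def)
  then show ?case by (simp add: Suc.IH)
qed

lemma measurable_iterates:
  assumes iter: "scgd_iterates M w v fv gw G UNIV \<alpha> \<beta> x0 y0 x y"
  shows "(\<lambda>\<omega>. (x k \<omega>, y k \<omega>)) \<in> measurable M (borel \<Otimes>\<^sub>M borel)"
proof -
  have "(\<lambda>\<omega>. \<lambda>i\<in>{..<k}. (w i \<omega>, v i \<omega>)) \<in> measurable M (Pi\<^sub>M {..<k} (\<lambda>_. W \<Otimes>\<^sub>M V))"
    by (intro measurable_restrict measurable_sample)
  from measurable_compose[OF this measurable_trajectory[OF order_refl]]
  have "(\<lambda>\<omega>. trajectory \<alpha> \<beta> (x0, y0) (\<lambda>i\<in>{..<k}. (w i \<omega>, v i \<omega>)) k) \<in> measurable M (borel \<Otimes>\<^sub>M borel)" .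
  also have "?this \<longleftrightarrow> ?thesis"
    by (intro measurable_cong) (auto simp: iterates_eq_trajectory[OF iter] intro!: trajectory_cong)
  finally show ?thesis .
qed

text \<open>This plays the role of conditioning on the past. The past and sample k have a product
  law, so the integral splits by Tonelli's theorem, which needs no integrability for a nonnegative
  \<open>\<psi>\<close>; equality of the laws then replaces sample k by a fresh copy of sample
  0.\<close>

lemma nn_integral_next_iterate:
  assumes iter: "scgd_iterates M w v fv gw G UNIV \<alpha> \<beta> x0 y0 x y"
    and \<psi> [measurable]: "\<psi> \<in> borel_measurable (borel \<Otimes>\<^sub>M borel)"
  shows "(\<integral>\<^sup>+ \<omega>. \<psi> (x (Suc k) \<omega>, y (Suc k) \<omega>) \<partial>M)
    = (\<integral>\<^sup>+ \<omega>. (\<integral>\<^sup>+ \<omega>'. \<psi> (step (\<alpha> k) (\<beta> k) (x k \<omega>, y k \<omega>) (w 0 \<omega>', v 0 \<omega>')) \<partial>M) \<partial>M)"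
proof -
  let ?N = "W \<Otimes>\<^sub>M V" and ?\<xi> = "\<lambda>k \<omega>. (w k \<omega>, v k \<omega>)"
  let ?A = "Pi\<^sub>M {..<k} (\<lambda>_. ?N)" and ?B = "Pi\<^sub>M {k} (\<lambda>_. ?N)"
  define P where "P \<omega> = (\<lambda>i\<in>{..<k}. ?\<xi> i \<omega>)" for \<omega>
  \<comment> \<open>The single sample is written as a function on the index set {k}, so that
    independence of blocks over disjoint index sets applies to the pair \<open>P\<close>,
    \<open>R\<close>.\<close>
  define R where "R \<omega> = (\<lambda>i\<in>{k}. ?\<xi> i \<omega>)" for \<omega>
  define h where "h p = \<psi> (step (\<alpha> k) (\<beta> k) (trajectory \<alpha> \<beta> (x0, y0) (fst p) k) (snd p k))" for p
  have P: "P \<in> measurable M ?A" and R: "R \<in> measurable M ?B"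
    unfolding P_def R_def by (intro measurable_restrict measurable_sample)+
  note P [measurable] R [measurable]
  note measurable_trajectory[OF order_refl, of \<alpha> \<beta> "(x0, y0)" k, measurable]
  note measurable_component_singleton[of k "{k}" "\<lambda>_. ?N", OF singletonI, measurable]
  have h [measurable]: "h \<in> borel_measurable (?A \<Otimes>\<^sub>M ?B)"
    unfolding h_def by measurable
  have hPR: "h (P \<omega>, R \<omega>') = \<psi> (step (\<alpha> k) (\<beta> k) (x k \<omega>, y k \<omega>) (?\<xi> k \<omega>'))" if "\<omega> \<in> space M" for \<omega> \<omega>'
  proof -
    have "trajectory \<alpha> \<beta> (x0, y0) (P \<omega>) k = (x k \<omega>, y k \<omega>)"
      unfolding iterates_eq_trajectory[OF iter that] P_def by (rule trajectory_cong) simp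
    then show ?thesis by (simp add: h_def R_def)
  qed
  have "indep_var ?A P ?B R"
    unfolding P_def R_def using indep by (rule indep_var_restrict) auto
  then have prod: "distr M (?A \<Otimes>\<^sub>M ?B) (\<lambda>\<omega>. (P \<omega>, R \<omega>)) = distr M ?A P \<Otimes>\<^sub>M distr M ?B R"
    by (simp add: indep_var_distribution_eq)
  interpret R: prob_space "distr M ?B R"
    using R by (rule prob_space_distr)
  have "(\<integral>\<^sup>+ \<omega>. \<psi> (x (Suc k) \<omega>, y (Suc k) \<omega>) \<partial>M) = (\<integral>\<^sup>+ \<omega>. h (P \<omega>, R \<omega>) \<partial>M)"
    by (intro nn_integral_cong) (simp add: hPR iterates_eq_trajectory[OF iter])
  also have "\<dots> = (\<integral>\<^sup>+ p. h p \<partial>distr M (?A \<Otimes>\<^sub>M ?B) (\<lambda>\<omega>. (P \<omega>, R \<omega>)))"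
    by (rule nn_integral_distr[symmetric]) measurable
  also have "\<dots> = (\<integral>\<^sup>+ p. (\<integral>\<^sup>+ r. h (p, r) \<partial>distr M ?B R) \<partial>distr M ?A P)"
    unfolding prod by (rule R.nn_integral_fst[symmetric]) simp
  also have "\<dots> = (\<integral>\<^sup>+ \<omega>. (\<integral>\<^sup>+ r. h (P \<omega>, r) \<partial>distr M ?B R) \<partial>M)"
    by (rule nn_integral_distr) (use P in \<open>simp_all add: R.borel_measurable_nn_integral\<close>)
  also have "\<dots> = (\<integral>\<^sup>+ \<omega>. (\<integral>\<^sup>+ \<omega>'. h (P \<omega>, R \<omega>') \<partial>M) \<partial>M)"
  proof (rule nn_integral_cong)
    fix \<omega> assume "\<omega> \<in> space M"
    then have "P \<omega> \<in> space ?A" by (rule measurable_space[OF P])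
    then have "(\<lambda>r. h (P \<omega>, r)) \<in> borel_measurable ?B"
      by measurable
    then show "(\<integral>\<^sup>+ r. h (P \<omega>, r) \<partial>distr M ?B R) = (\<integral>\<^sup>+ \<omega>'. h (P \<omega>, R \<omega>') \<partial>M)"
      by (intro nn_integral_distr R) simp
  qed
  also have "\<dots> = (\<integral>\<^sup>+ \<omega>. (\<integral>\<^sup>+ \<omega>'. \<psi> (step (\<alpha> k) (\<beta> k) (x k \<omega>, y k \<omega>) (?\<xi> 0 \<omega>')) \<partial>M) \<partial>M)"
  proof (rule nn_integral_cong)
    fix \<omega> assume \<omega>: "\<omega> \<in> space M"
    let ?\<phi> = "\<lambda>\<xi>. \<psi> (step (\<alpha> k) (\<beta> k) (x k \<omega>, y k \<omega>) \<xi>)"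
    have "(x k \<omega>, y k \<omega>) \<in> space (borel \<Otimes>\<^sub>M borel)" by (simp add: space_pair_measure)
    then have \<phi>: "?\<phi> \<in> borel_measurable ?N" by measurable
    have law: "(\<integral>\<^sup>+ \<omega>'. ?\<phi> (?\<xi> i \<omega>') \<partial>M) = (\<integral>\<^sup>+ \<xi>. ?\<phi> \<xi> \<partial>distr M ?N (?\<xi> i))" for i
      by (rule nn_integral_distr[OF measurable_sample, symmetric]) (simp add: \<phi>)
    have "(\<integral>\<^sup>+ \<omega>'. h (P \<omega>, R \<omega>') \<partial>M) = (\<integral>\<^sup>+ \<omega>'. ?\<phi> (?\<xi> k \<omega>') \<partial>M)"
      by (simp add: hPR[OF \<omega>])
    also have "\<dots> = (\<integral>\<^sup>+ \<omega>'. ?\<phi> (?\<xi> 0 \<omega>') \<partial>M)"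
      unfolding law identically_distributed[of k] ..
    finally show "(\<integral>\<^sup>+ \<omega>'. h (P \<omega>, R \<omega>') \<partial>M) = (\<integral>\<^sup>+ \<omega>'. ?\<phi> (?\<xi> 0 \<omega>') \<partial>M)" .
  qed
  finally show ?thesis .
qed

section \<open>Decay of the expected squared gradient along the iterates\<close>

text \<open>In \<open>ennreal\<close> a possibly infinite term cannot be cancelled by subtraction,
  so both recursions are stated additively there. They are converted into real inequalities once all
  three expectations are known to be finite.\<close>

lemma gradient_rate:
  assumes ab: "0 < a" "0 < b" and pos: "0 < rate_exponent a b"
    and steps: "power_stepsizes a b \<alpha> \<beta>"
    and iter: "scgd_iterates M w v fv gw G UNIV \<alpha> \<beta> x0 y0 x y"
  shows "\<exists>C>0. \<forall>K\<ge>1. \<exists>t\<in>{1..K}.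
    (\<integral>\<^sup>+ \<omega>. ennreal ((norm (grad F (x t \<omega>)))\<^sup>2) \<partial>M) \<le> ennreal (C * real K powr (- rate_exponent a b))"
proof -
  obtain xs where "\<And>z. F xs \<le> F z"
    using optimal_solution unfolding F_def by auto
  then obtain Fmin where lower: "\<And>z. Fmin \<le> F z" by blast
  have \<alpha>: "0 < \<alpha> k" "\<alpha> k \<le> 1" and \<beta>: "0 < \<beta> k" "\<beta> k \<le> 1" for k
  proof -
    have "real k powr (- c) \<le> 1" if "1 \<le> k" "0 < c" for c
      using that powr_mono[of "- c" 0 "real k"] by simp
    then show "0 < \<alpha> k" "\<alpha> k \<le> 1" "0 < \<beta> k" "\<beta> k \<le> 1"
      using steps ab unfolding power_stepsizes_def by (cases "k = 0"; simp)+
  qed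
  define c1 where "c1 = (L\<^sub>f * (1 + C\<^sub>g) / 2)\<^sup>2"
  define c2 where "c2 = (L\<^sub>f * (C\<^sub>g + V\<^sub>g) / 2)\<^sup>2"
  define c3 where "c3 = L\<^sub>F * C\<^sub>g * C\<^sub>f"
  define c4 where "c4 = 2 * V\<^sub>g"
  define c5 where "c5 = 2 * C\<^sub>g ^ 3 * C\<^sub>f"
  have c: "0 \<le> c1" "0 \<le> c2" "0 \<le> c3" "0 \<le> c4" "0 \<le> c5"
    unfolding c1_def c2_def c3_def c4_def c5_def
    using positive lipschitz_on_nonneg[OF F_smooth] by simp_all
  define e where "e k = c2 * \<alpha> k * (\<beta> k)\<^sup>2 + c3 * (\<alpha> k)\<^sup>2" for k
  define e' where "e' k = c4 * (\<beta> k)\<^sup>2 + c5 * ((\<alpha> k)\<^sup>2 / \<beta> k)" for k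
  have e: "0 \<le> e k" "0 \<le> e' k" for k
    unfolding e_def e'_def using c \<alpha>(1)[of k] \<beta>(1)[of k] by simp_all
  define EA where "EA k = (\<integral>\<^sup>+ \<omega>. ennreal (F (x k \<omega>) - Fmin) \<partial>M)" for k
  define ED where "ED k = (\<integral>\<^sup>+ \<omega>. ennreal ((norm (y k \<omega> - g (x k \<omega>)))\<^sup>2) \<partial>M)" for k
  define EN where "EN k = (\<integral>\<^sup>+ \<omega>. ennreal ((norm (grad F (x k \<omega>)))\<^sup>2) \<partial>M)" for k
  have x [measurable]: "x k \<in> borel_measurable M" and y [measurable]: "y k \<in> borel_measurable M" for k
    using measurable_compose[OF measurable_iterates[OF iter] measurable_fst]
      measurable_compose[OF measurable_iterates[OF iter] measurable_snd] by simp_all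
  note measurable_sample [measurable]
  have EA_step: "EA (Suc k) + ennreal (\<alpha> k / 2) * EN k \<le> EA k + ennreal (c1 * \<alpha> k) * ED k + ennreal (e k)" for k
  proof -
    define J where "J \<omega> = (\<integral>\<^sup>+ \<omega>'. ennreal (F (fst (step (\<alpha> k) (\<beta> k) (x k \<omega>, y k \<omega>) (w 0 \<omega>', v 0 \<omega>'))) - Fmin) \<partial>M)" for \<omega>
    have [measurable]: "J \<in> borel_measurable M" unfolding J_def by measurable
    have "EA (Suc k) + ennreal (\<alpha> k / 2) * EN k = (\<integral>\<^sup>+ \<omega>. J \<omega> \<partial>M) + (\<integral>\<^sup>+ \<omega>. ennreal (\<alpha> k / 2) * ennreal ((norm (grad F (x k \<omega>)))\<^sup>2) \<partial>M)"
      unfolding EA_def EN_def J_def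
      using nn_integral_next_iterate[OF iter, of "\<lambda>s. ennreal (F (fst s) - Fmin)" k]
      by (simp add: nn_integral_cmult)
    also have "\<dots> = (\<integral>\<^sup>+ \<omega>. J \<omega> + ennreal (\<alpha> k / 2) * ennreal ((norm (grad F (x k \<omega>)))\<^sup>2) \<partial>M)"
      by (rule nn_integral_add[symmetric]) measurable
    also have "\<dots> \<le> (\<integral>\<^sup>+ \<omega>. ennreal (F (x k \<omega>) - Fmin) + ennreal (c1 * \<alpha> k) * ennreal ((norm (y k \<omega> - g (x k \<omega>)))\<^sup>2) + ennreal (e k) \<partial>M)"
    proof (rule nn_integral_mono)
      fix \<omega>
      have "J \<omega> + ennreal (\<alpha> k / 2) * ennreal ((norm (grad F (x k \<omega>)))\<^sup>2)
          = J \<omega> + ennreal (\<alpha> k / 2 * (norm (grad F (x k \<omega>)))\<^sup>2)"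
        using \<alpha>(1)[of k] by (subst ennreal_mult') simp_all
      also have "\<dots> \<le> ennreal (F (x k \<omega>) - Fmin + c1 * \<alpha> k * (norm (y k \<omega> - g (x k \<omega>)))\<^sup>2 + e k)"
        using one_step_objective[of "\<alpha> k" "\<beta> k" Fmin "x k \<omega>" "y k \<omega>", OF _ _ _ lower] \<alpha>(1)[of k] \<beta>[of k]
        unfolding J_def step_def Let_def c1_def c2_def c3_def e_def by simp
      also have "\<dots> = ennreal (F (x k \<omega>) - Fmin) + ennreal (c1 * \<alpha> k) * ennreal ((norm (y k \<omega> - g (x k \<omega>)))\<^sup>2) + ennreal (e k)"
        using lower[of "x k \<omega>"] c(1) \<alpha>(1)[of k] e[of k]
        by (simp add: ennreal_plus ennreal_mult')
      finally show "J \<omega> + ennreal (\<alpha> k / 2) * ennreal ((norm (grad F (x k \<omega>)))\<^sup>2) \<le> \<dots>" .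
    qed
    also have "\<dots> = EA k + ennreal (c1 * \<alpha> k) * ED k + ennreal (e k)"
      unfolding EA_def ED_def by (simp add: nn_integral_add nn_integral_cmult emeasure_space_1)
    finally show ?thesis .
  qed
  have ED_step: "ED (Suc k) \<le> ennreal (1 - \<beta> k) * ED k + ennreal (e' k)" for k
  proof -
    have "ED (Suc k) = (\<integral>\<^sup>+ \<omega>. (\<integral>\<^sup>+ \<omega>'. ennreal ((norm (snd (step (\<alpha> k) (\<beta> k) (x k \<omega>, y k \<omega>) (w 0 \<omega>', v 0 \<omega>'))
        - g (fst (step (\<alpha> k) (\<beta> k) (x k \<omega>, y k \<omega>) (w 0 \<omega>', v 0 \<omega>')))))\<^sup>2) \<partial>M) \<partial>M)"
      unfolding ED_def
      using nn_integral_next_iterate[OF iter, of "\<lambda>s. ennreal ((norm (snd s - g (fst s)))\<^sup>2)" k] by simp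
    also have "\<dots> \<le> (\<integral>\<^sup>+ \<omega>. ennreal (1 - \<beta> k) * ennreal ((norm (y k \<omega> - g (x k \<omega>)))\<^sup>2) + ennreal (e' k) \<partial>M)"
    proof (rule nn_integral_mono)
      fix \<omega>
      have "(\<integral>\<^sup>+ \<omega>'. ennreal ((norm (snd (step (\<alpha> k) (\<beta> k) (x k \<omega>, y k \<omega>) (w 0 \<omega>', v 0 \<omega>'))
          - g (fst (step (\<alpha> k) (\<beta> k) (x k \<omega>, y k \<omega>) (w 0 \<omega>', v 0 \<omega>')))))\<^sup>2) \<partial>M)
        \<le> ennreal ((1 - \<beta> k) * (norm (y k \<omega> - g (x k \<omega>)))\<^sup>2 + e' k)"
        using one_step_tracking[of "\<beta> k" "y k \<omega>" "x k \<omega>" "\<alpha> k"] \<beta>[of k]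
        unfolding step_def Let_def c4_def c5_def e'_def by simp
      also have "\<dots> = ennreal (1 - \<beta> k) * ennreal ((norm (y k \<omega> - g (x k \<omega>)))\<^sup>2) + ennreal (e' k)"
        using \<beta>[of k] e[of k] by (simp add: ennreal_plus ennreal_mult')
      finally show "(\<integral>\<^sup>+ \<omega>'. ennreal ((norm (snd (step (\<alpha> k) (\<beta> k) (x k \<omega>, y k \<omega>) (w 0 \<omega>', v 0 \<omega>'))
          - g (fst (step (\<alpha> k) (\<beta> k) (x k \<omega>, y k \<omega>) (w 0 \<omega>', v 0 \<omega>')))))\<^sup>2) \<partial>M) \<le> \<dots>" .
    qed
    also have "\<dots> = ennreal (1 - \<beta> k) * ED k + ennreal (e' k)"
      unfolding ED_def by (simp add: nn_integral_add nn_integral_cmult emeasure_space_1)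
    finally show ?thesis .
  qed
  \<comment> \<open>The starting point is deterministic, and the two recursions propagate finiteness
    jointly, since the bound on the objective involves the tracking error.\<close>
  have finite: "EA k < \<top> \<and> ED k < \<top>" for k
  proof (induction k)
    case 0
    have init: "x 0 \<omega> = x0" "y 0 \<omega> = y0" if "\<omega> \<in> space M" for \<omega>
      using iter that unfolding scgd_iterates_def by auto
    have "EA 0 = (\<integral>\<^sup>+ \<omega>. ennreal (F x0 - Fmin) \<partial>M)"
      unfolding EA_def by (rule nn_integral_cong) (simp add: init)
    moreover have "ED 0 = (\<integral>\<^sup>+ \<omega>. ennreal ((norm (y0 - g x0))\<^sup>2) \<partial>M)"
      unfolding ED_def by (rule nn_integral_cong) (simp add: init)
    ultimately show ?case by (simp add: emeasure_space_1)
  next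
    case (Suc k)
    have "EA (Suc k) \<le> EA (Suc k) + ennreal (\<alpha> k / 2) * EN k" by simp
    also note EA_step[of k]
    also have "EA k + ennreal (c1 * \<alpha> k) * ED k + ennreal (e k) < \<top>"
      using Suc.IH by (simp add: ennreal_mult_less_top)
    finally have "EA (Suc k) < \<top>" .
    moreover have "ennreal (1 - \<beta> k) * ED k + ennreal (e' k) < \<top>"
      using Suc.IH by (simp add: ennreal_mult_less_top)
    then have "ED (Suc k) < \<top>" by (rule le_less_trans[OF ED_step])
    ultimately show ?case ..
  qed
  \<comment> \<open>The objective recursion controls the gradient term only after multiplication by
    \<open>\<alpha> k / 2\<close>; positivity of \<open>\<alpha> k\<close> removes this
    factor.\<close>
  have finite_N: "EN k < \<top>" for k
  proof -
    have "ennreal (\<alpha> k / 2) * EN k \<le> EA (Suc k) + ennreal (\<alpha> k / 2) * EN k" by simp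
    also note EA_step[of k]
    also have "EA k + ennreal (c1 * \<alpha> k) * ED k + ennreal (e k) < \<top>"
      using finite[of k] by (simp add: ennreal_mult_less_top)
    finally show ?thesis
      using \<alpha>(1)[of k] by (auto simp: ennreal_mult_less_top)
  qed
  define A where "A k = enn2real (EA k)" for k
  define D where "D k = enn2real (ED k)" for k
  define N where "N k = enn2real (EN k)" for k
  have real: "EA k = ennreal (A k)" "ED k = ennreal (D k)" "EN k = ennreal (N k)"
    and nonneg: "0 \<le> A k" "0 \<le> D k" "0 \<le> N k" for k
    unfolding A_def D_def N_def using finite[of k] finite_N[of k] by simp_all
  have A_step: "A (Suc k) + \<alpha> k / 2 * N k \<le> A k + c1 * \<alpha> k * D k + (c2 * \<alpha> k * (\<beta> k)\<^sup>2 + c3 * (\<alpha> k)\<^sup>2)" for k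
  proof -
    have "ennreal (A (Suc k) + \<alpha> k / 2 * N k) \<le> ennreal (A k + c1 * \<alpha> k * D k + e k)"
      using EA_step[of k] nonneg[of k] nonneg[of "Suc k"] \<alpha>(1)[of k] c e[of k]
      by (simp add: real ennreal_plus ennreal_mult' del: times_divide_eq_left)
    moreover have "0 \<le> A k + c1 * \<alpha> k * D k + e k"
      using nonneg[of k] \<alpha>(1)[of k] c e[of k] by simp
    ultimately show ?thesis unfolding e_def by (simp add: ennreal_le_iff)
  qed
  have D_step: "D (Suc k) \<le> (1 - \<beta> k) * D k + (c4 * (\<beta> k)\<^sup>2 + c5 * ((\<alpha> k)\<^sup>2 / \<beta> k))" for k
  proof -
    have "ennreal (D (Suc k)) \<le> ennreal ((1 - \<beta> k) * D k + e' k)"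
      using ED_step[of k] nonneg[of k] \<beta>[of k] e[of k]
      by (simp add: real ennreal_plus ennreal_mult')
    moreover have "0 \<le> (1 - \<beta> k) * D k + e' k"
      using nonneg[of k] \<beta>[of k] e[of k] by simp
    ultimately show ?thesis unfolding e'_def by (simp add: ennreal_le_iff)
  qed
  have \<alpha>_eq: "\<alpha> k = real k powr (- a)" and \<beta>_eq: "\<beta> k = real k powr (- b)" if "1 \<le> k" for k
    using steps that unfolding power_stepsizes_def by simp_all
  have "\<exists>C>0. \<forall>K\<ge>1. \<exists>t\<in>{1..K}. N t \<le> C * real K powr (- rate_exponent a b)"
    by (rule two_timescale_rate[where \<alpha> = \<alpha> and \<beta> = \<beta> and A = A and D = D and N = N,
        OF ab pos \<alpha>_eq \<beta>_eq nonneg(1,2) c A_step D_step])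
  then show ?thesis
    using real(3) unfolding EN_def by (metis ennreal_leI)
qed

end

theorem theorem8:
  fixes M :: "'a measure" and W :: "'w measure" and V :: "'v measure"
    and w :: "nat \<Rightarrow> 'a \<Rightarrow> 'w" and v :: "nat \<Rightarrow> 'a \<Rightarrow> 'v"
    and f :: "real ^ 'm \<Rightarrow> real" and fv :: "'v \<Rightarrow> real ^ 'm \<Rightarrow> real"
    and g :: "real ^ 'n \<Rightarrow> real ^ 'm" and gw :: "'w \<Rightarrow> real ^ 'n \<Rightarrow> real ^ 'm"
    and G :: "'w \<Rightarrow> real ^ 'n \<Rightarrow> real ^ 'm ^ 'n"
    and X :: "(real ^ 'n) set" and F :: "real ^ 'n \<Rightarrow> real"
    and C\<^sub>g C\<^sub>f V\<^sub>g L\<^sub>f L\<^sub>F :: real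
  assumes assumption1: "scgd_assumption M W V w v f fv g gw G X C\<^sub>g C\<^sub>f V\<^sub>g L\<^sub>f"
    and F_def: "F = f \<circ> g"
    and differentiable: "\<And>z. F differentiable (at z)"
    and smooth: "L\<^sub>F-lipschitz_on UNIV (grad F)"
    and unconstrained: "X = UNIV"
  shows "(\<forall>a b \<alpha> \<beta> x0 y0 x y.
            a \<in> {0<..<1} \<and> b \<in> {0<..<1} \<and> rate_exponent a b > 0 \<and>
            power_stepsizes a b \<alpha> \<beta> \<and>
            scgd_iterates M w v fv gw G X \<alpha> \<beta> x0 y0 x y \<longrightarrow>
              (\<forall>\<epsilon>>0. \<exists>k. small_gradient M F x \<epsilon> k) \<and>
              (\<lambda>\<epsilon>. real (iteration_complexity M F x \<epsilon>))
                \<in> O[at_right 0](\<lambda>\<epsilon>. \<epsilon> powr (- 1 / rate_exponent a b)))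
       \<and> (\<forall>a b \<epsilon>. a \<in> {0<..<1} \<and> b \<in> {0<..<1} \<and> rate_exponent a b > 0 \<and> \<epsilon> \<in> {0<..<1} \<longrightarrow>
            \<epsilon> powr (- 1 / rate_exponent (3/4) (1/2)) \<le> \<epsilon> powr (- 1 / rate_exponent a b))
       \<and> (\<forall>\<alpha> \<beta> x0 y0 x y.
            power_stepsizes (3/4) (1/2) \<alpha> \<beta> \<and>
            scgd_iterates M w v fv gw G X \<alpha> \<beta> x0 y0 x y \<longrightarrow>
              (\<forall>\<epsilon>>0. \<exists>k. small_gradient M F x \<epsilon> k) \<and>
              (\<lambda>\<epsilon>. real (iteration_complexity M F x \<epsilon>))
                \<in> O[at_right 0](\<lambda>\<epsilon>. \<epsilon> powr (-4)))"
proof -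
  interpret scgd_smooth M W V w v f fv g gw G C\<^sub>g C\<^sub>f V\<^sub>g L\<^sub>f F L\<^sub>F
    using assumption1 F_def differentiable smooth unfolding unconstrained
    by (simp add: scgd_smooth_def scgd_smooth_axioms_def)
  have main: "(\<forall>\<epsilon>>0. \<exists>k. small_gradient M F x \<epsilon> k) \<and>
      (\<lambda>\<epsilon>. real (iteration_complexity M F x \<epsilon>)) \<in> O[at_right 0](\<lambda>\<epsilon>. \<epsilon> powr (- 1 / rate_exponent a b))"
    if ab: "0 < a" "0 < b" and pos: "0 < rate_exponent a b" and steps: "power_stepsizes a b \<alpha> \<beta>"
      and iter: "scgd_iterates M w v fv gw G X \<alpha> \<beta> x0 y0 x y" for a b \<alpha> \<beta> x0 y0 x y
  proof -
    obtain C where "0 < C" and "\<And>K. 1 \<le> K \<Longrightarrow> \<exists>t\<in>{1..K}.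
        (\<integral>\<^sup>+ \<omega>. ennreal ((norm (grad F (x t \<omega>)))\<^sup>2) \<partial>M) \<le> ennreal (C * real K powr (- rate_exponent a b))"
      using gradient_rate[OF ab pos steps iter[unfolded unconstrained]] by blast
    then show ?thesis
      using complexity_of_rate[OF _ pos] by blast
  qed
  have quarter: "rate_exponent (3/4) (1/2) = 1/4"
    unfolding rate_exponent_def by simp
  have "\<epsilon> powr (- 1 / rate_exponent (3/4) (1/2)) \<le> \<epsilon> powr (- 1 / rate_exponent a b)"
    if "rate_exponent a b > 0" "0 < \<epsilon>" "\<epsilon> < 1" for a b \<epsilon>
  proof (rule powr_mono')
    \<comment> \<open>With weights 1, 2, 1 the bounds add up to (1 - a) + 2 * (a - b) + (2 * b - a)
      = 1. All three equal 1 / 4 at a = 3/4, b = 1/2, which makes this choice optimal.\<close>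
    have "rate_exponent a b \<le> 1 / 4"
      using rate_exponent_le[where a = a and b = b] by linarith
    then show "- 1 / rate_exponent a b \<le> - 1 / rate_exponent (3/4) (1/2)"
      unfolding quarter using that by (simp add: field_simps)
  qed (use that in auto)
  moreover have "(\<forall>\<epsilon>>0. \<exists>k. small_gradient M F x \<epsilon> k) \<and>
      (\<lambda>\<epsilon>. real (iteration_complexity M F x \<epsilon>)) \<in> O[at_right 0](\<lambda>\<epsilon>. \<epsilon> powr (-4))"
    if "power_stepsizes (3/4) (1/2) \<alpha> \<beta>" "scgd_iterates M w v fv gw G X \<alpha> \<beta> x0 y0 x y" for \<alpha> \<beta> x0 y0 x y
    using main[of "3/4" "1/2", OF _ _ _ that] by (simp add: quarter)
  ultimately show ?thesis
    using main by (intro conjI allI impI) auto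
qed

end
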